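(* Let $\mathcal G$ and its dual $\mathcal G^*$ be dually paired. Then $(\mathcal G,\cdot,\Delta)$ is a (unital) associative 2-bialgebra if and only if $(\mathcal G^*,\cdot^*,\Delta^* )$ is a (unital) associative 2-bialgebra.
   Context: Everything is finite dimensional over a field $k$; $x,x'\in\mathcal G_0$, $y,y'\in\mathcal G_{-1}$. **Associative 2-algebra** $\mathcal G$: associative algebras $\mathcal G_0,\mathcal G_{-1}$, an algebra homomorphism $t:\mathcal G_{-1}\to\mathcal G_0$ and bilinear actions $x\cdot y,\ y\cdot x\in\mathcal G_{-1}$ with $(x'x)\cdot y=x'\cdot(x\cdot y)$, $(x\cdot y)\cdot x'=x\cdot(y\cdot x')$, $y\cdot(xx')=(y\cdot x)\cdot x'$; $t(x\cdot y)=x\,t(y)$, $t(y\cdot x)=t(y)x$; $t(y)\cdot y'=yy'=y\cdot t(y')$. Unital: units $\eta_{-1},\eta_0$ of $\mathcal G_{-1},\mathcal G_0$ with $t\eta_{-1}=\eta_0$ and $\eta_0$ acting as identity on $\mathcal G_{-1}$. **Coassociative 2-coalgebra**: maps $\Delta_{-1}:\mathcal G_{-1}\to\mathcal G_{-1}^{\otimes2}$, $\Delta_0=\Delta_0^l+\Delta_0^r$, $\Delta_0^l:\mathcal G_0\to\mathcal G_{-1}\otimes\mathcal G_0$, $\Delta_0^r:\mathcal G_0\to\mathcal G_0\otimes\mathcal G_{-1}$, $\Delta_0':\mathcal G_0\to\mathcal G_0^{\otimes2}$, with $\Delta_{-1},\Delta_0'$ coassociative; $(\Delta_{-1}\otimes\mathrm{id})\Delta_0^l=(\mathrm{id}\otimes\Delta_0^l)\Delta_0^l$,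 $(\mathrm{id}\otimes\Delta_{-1})\Delta_0^r=(\Delta_0^r\otimes\mathrm{id})\Delta_0^r$, $(\mathrm{id}\otimes\Delta_0^r)\Delta_0^l=(\Delta_0^l\otimes\mathrm{id})\Delta_0^r$; $t$ a coalgebra homomorphism with $(t\otimes1+1\otimes t)\Delta_{-1}=\Delta_0t$ and $(t\otimes\mathrm{id})\Delta_0^l=\Delta_0'=(\mathrm{id}\otimes t)\Delta_0^r$. Counital: $\epsilon=(\epsilon_{-1},\epsilon_0)$ with $(\mathrm{id}\otimes\epsilon_{-1})\Delta_{-1}=\mathrm{id}=(\epsilon_{-1}\otimes\mathrm{id})\Delta_{-1}$, $(\epsilon_{-1}\otimes\mathrm{id})\Delta_0^l=\mathrm{id}=(\mathrm{id}\otimes\epsilon_{-1})\Delta_0^r$, $\epsilon_{-1}=\epsilon_0t$, and $(\epsilon_0\otimes\mathrm{id})\Delta_0'=\mathrm{id}=(\mathrm{id}\otimes\epsilon_0)\Delta_0'$. **Associative 2-bialgebra**: both an associative 2-algebra and a coassociative 2-coalgebra, with (Sweedler: $\Delta_{-1}(y)=y_{(1)}\otimes y_{(2)}$, $\Delta_0^{l,r}(x)=x^{l,r}_{(1)}\otimes x^{l,r}_{(2)}$, $\Delta_0'(x)=\bar x_{(1)}\otimes\bar x_{(2)}$) $\Delta_{-1}(x\cdot y)=\bar x_{(1)}\cdot y_{(1)}\otimes\bar x_{(2)}\cdot y_{(2)}$, $\Delta_{-1}(y\cdot x)=y_{(1)}\cdot\bar x_{(1)}\otimes y_{(2)}\cdot\bar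 x_{(2)}$, $\Delta_0^{l}(xx')=x_{(1)}^{l}x_{(1)}'^{l}\otimes x_{(2)}^{l}x_{(2)}'^{l}$, $\Delta_0^{r}(xx')=x_{(1)}^{r}x_{(1)}'^{r}\otimes x_{(2)}^{r}x_{(2)}'^{r}$. Unital means both unital and counital. **Dual pairing.** $\mathcal G^*$ has degree-0 part the dual space $\mathcal G_{-1}^*\ni f$, degree-$(-1)$ part $\mathcal G_0^*\ni g$, pairing $\langle(g,f),(y,x)\rangle=\langle f,y\rangle+\langle g,x\rangle$, and $t$-map $t^*:\mathcal G_0^*\to\mathcal G_{-1}^*$, $\langle t^*\cdot,\cdot\rangle=\langle\cdot,t\cdot\rangle$. The structure $(\cdot^*,\Delta^* )$ is induced by duality: $\langle ff',y\rangle=\langle f\otimes f',\Delta_{-1}y\rangle$, $\langle gg',x\rangle=\langle g\otimes g',\Delta_0'x\rangle$, $\langle f\cdot^*g,x\rangle=\langle f\otimes g,\Delta_0^lx\rangle$, $\langle g\cdot^*f,x\rangle=\langle g\otimes f,\Delta_0^rx\rangle$, $\langle\Delta_0^{*\prime}f,y\otimes y'\rangle=\langle f,yy'\rangle$, $\langle\Delta_{-1}^*g,x\otimes x'\rangle=\langle g,xx'\rangle$, $\langle\Delta_0^{*l}f,x\otimes y\rangle=\langle f,x\cdot y\rangle$, $\langle\Delta_0^{*r}f,y\otimes x\rangle=\langle f,y\cdot x\rangle$; units and counits of $\mathcal G^*$ are the transposes of counits and units of $\mathcal G$. *)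

theory Defs
  imports Complex_Main "HOL-Library.Function_Algebras"
begin

section \<open>Finite-dimensional vector spaces, dual spaces\<close>

text \<open>
  A vector space over the field \<open>'k\<close> is a subspace of a type carrying a \<^locale>\<open>vector_space\<close>
  structure. Carriers are explicit because the dual and the tensor product of two spaces given by
  sets are again only sets (of functions), not types.
\<close>

record ('k, 'v) vspace =
  vcarrier :: "'v set"
  vscale :: "'k \<Rightarrow> 'v \<Rightarrow> 'v"

definition fin_dim_vspace :: "('k::field, 'v::ab_group_add) vspace \<Rightarrow> bool" where
  "fin_dim_vspace V \<longleftrightarrow>
     vector_space (vscale V) \<and> (\<exists>B. finite B \<and> vcarrier V = module.span (vscale V) B)"

definition linear_between ::
    "('k::field, 'v::ab_group_add) vspace \<Rightarrow> ('k, 'w::ab_group_add) vspace \<Rightarrow> ('v \<Rightarrow> 'w) \<Rightarrow> bool" where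
  "linear_between V W T \<longleftrightarrow>
     (\<forall>v\<in>vcarrier V. T v \<in> vcarrier W) \<and>
     (\<forall>v\<in>vcarrier V. \<forall>v'\<in>vcarrier V. T (v + v') = T v + T v') \<and>
     (\<forall>c. \<forall>v\<in>vcarrier V. T (vscale V c v) = vscale W c (T v))"

definition bilinear_between ::
    "('k::field, 'u::ab_group_add) vspace \<Rightarrow> ('k, 'v::ab_group_add) vspace \<Rightarrow>
     ('k, 'w::ab_group_add) vspace \<Rightarrow> ('u \<Rightarrow> 'v \<Rightarrow> 'w) \<Rightarrow> bool" where
  "bilinear_between U V W \<beta> \<longleftrightarrow>
     (\<forall>u\<in>vcarrier U. linear_between V W (\<beta> u)) \<and>
     (\<forall>v\<in>vcarrier V. linear_between U W (\<lambda>u. \<beta> u v))"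

definition ground :: "('k::field, 'k) vspace" where
  "ground = \<lparr>vcarrier = UNIV, vscale = (*)\<rparr>"

definition restrict0 :: "('k, 'v) vspace \<Rightarrow> ('v \<Rightarrow> 'c::zero) \<Rightarrow> 'v \<Rightarrow> 'c" where
  "restrict0 V f = (\<lambda>v. if v \<in> vcarrier V then f v else 0)"

text \<open>
  A functional on \<open>V\<close> is represented by the function that vanishes outside the carrier, so that
  functionals agreeing on the carrier are equal.
\<close>

definition dual_space :: "('k::field, 'v::ab_group_add) vspace \<Rightarrow> ('k, 'v \<Rightarrow> 'k) vspace" where
  "dual_space V =
     \<lparr>vcarrier = {f. linear_between V ground f \<and> (\<forall>v. v \<notin> vcarrier V \<longrightarrow> f v = 0)},
      vscale = (\<lambda>c f v. c * f v)\<rparr>"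

section \<open>Tensor products\<close>

text \<open>
  \<open>V \<otimes> W\<close> is realised inside the bilinear forms on \<open>V\<^sup>* \<times> W\<^sup>*\<close>: the pure tensor \<open>v \<otimes> w\<close> is
  \<open>(f, g) \<mapsto> f(v) g(w)\<close>, and \<open>V \<otimes> W\<close> is the span of the pure tensors. Over a field this is the usual
  tensor product. It is used below only through pure tensors and \<open>tensor_lift\<close>, the extension of a
  bilinear map to the tensor product.
\<close>

type_synonym ('k, 'v, 'w) tensor = "('v \<Rightarrow> 'k) \<Rightarrow> ('w \<Rightarrow> 'k) \<Rightarrow> 'k"

definition pure_tensor ::
    "('k::field, 'v::ab_group_add) vspace \<Rightarrow> ('k, 'w::ab_group_add) vspace \<Rightarrow>
     'v \<Rightarrow> 'w \<Rightarrow> ('k, 'v, 'w) tensor" where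
  "pure_tensor V W v w =
     (\<lambda>f g. if f \<in> vcarrier (dual_space V) \<and> g \<in> vcarrier (dual_space W) then f v * g w else 0)"

definition tensor_scale :: "'k::field \<Rightarrow> ('k, 'v, 'w) tensor \<Rightarrow> ('k, 'v, 'w) tensor" where
  "tensor_scale c p = (\<lambda>f g. c * p f g)"

definition tensor_space ::
    "('k::field, 'v::ab_group_add) vspace \<Rightarrow> ('k, 'w::ab_group_add) vspace \<Rightarrow>
     ('k, ('k, 'v, 'w) tensor) vspace" where
  "tensor_space V W =
     \<lparr>vcarrier = module.span tensor_scale
        {pure_tensor V W v w | v w. v \<in> vcarrier V \<and> w \<in> vcarrier W},
      vscale = tensor_scale\<rparr>"

text \<open>
  Sweedler notation: \<open>tensor_lift V W \<beta> p\<close> is \<open>\<Sum> \<beta>(p\<^sub>(\<^sub>1\<^sub>), p\<^sub>(\<^sub>2\<^sub>))\<close> for any way of writing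
  \<open>p = \<Sum> p\<^sub>(\<^sub>1\<^sub>) \<otimes> p\<^sub>(\<^sub>2\<^sub>)\<close> as a finite sum of pure tensors; for bilinear \<open>\<beta>\<close> the result does not depend
  on the chosen representation.
\<close>

definition tensor_repr ::
    "('k::field, 'v::ab_group_add) vspace \<Rightarrow> ('k, 'w::ab_group_add) vspace \<Rightarrow>
     ('k, 'v, 'w) tensor \<Rightarrow> ('v \<times> 'w) list \<Rightarrow> bool" where
  "tensor_repr V W p ps \<longleftrightarrow>
     set ps \<subseteq> vcarrier V \<times> vcarrier W \<and> p = (\<Sum>(v, w)\<leftarrow>ps. pure_tensor V W v w)"

definition tensor_lift ::
    "('k::field, 'v::ab_group_add) vspace \<Rightarrow> ('k, 'w::ab_group_add) vspace \<Rightarrow>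
     ('v \<Rightarrow> 'w \<Rightarrow> 'u::ab_group_add) \<Rightarrow> ('k, 'v, 'w) tensor \<Rightarrow> 'u" where
  "tensor_lift V W \<beta> p = (\<Sum>(v, w)\<leftarrow>(SOME ps. tensor_repr V W p ps). \<beta> v w)"

text \<open>\<open>S \<otimes> T : V \<otimes> W \<rightarrow> V' \<otimes> W'\<close>\<close>

definition tensor_map ::
    "('k::field, 'v::ab_group_add) vspace \<Rightarrow> ('k, 'w::ab_group_add) vspace \<Rightarrow>
     ('k, 'v'::ab_group_add) vspace \<Rightarrow> ('k, 'w'::ab_group_add) vspace \<Rightarrow>
     ('v \<Rightarrow> 'v') \<Rightarrow> ('w \<Rightarrow> 'w') \<Rightarrow> ('k, 'v, 'w) tensor \<Rightarrow> ('k, 'v', 'w') tensor" where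
  "tensor_map V W V' W' S T = tensor_lift V W (\<lambda>v w. pure_tensor V' W' (S v) (T w))"

text \<open>\<open>(U \<otimes> V) \<otimes> W \<rightarrow> U \<otimes> (V \<otimes> W)\<close>\<close>

definition tensor_assoc ::
    "('k::field, 'u::ab_group_add) vspace \<Rightarrow> ('k, 'v::ab_group_add) vspace \<Rightarrow>
     ('k, 'w::ab_group_add) vspace \<Rightarrow>
     ('k, ('k, 'u, 'v) tensor, 'w) tensor \<Rightarrow> ('k, 'u, ('k, 'v, 'w) tensor) tensor" where
  "tensor_assoc U V W =
     tensor_lift (tensor_space U V) W
       (\<lambda>p w. tensor_lift U V
         (\<lambda>u v. pure_tensor U (tensor_space V W) u (pure_tensor V W v w)) p)"

text \<open>
  For \<open>\<beta> : V \<times> W \<rightarrow> U\<close> and \<open>\<gamma> : V' \<times> W' \<rightarrow> U'\<close>, the map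
  \<open>(V \<otimes> V') \<times> (W \<otimes> W') \<rightarrow> U \<otimes> U'\<close> sending \<open>(p, q)\<close> to
  \<open>\<Sum> \<beta>(p\<^sub>(\<^sub>1\<^sub>), q\<^sub>(\<^sub>1\<^sub>)) \<otimes> \<gamma>(p\<^sub>(\<^sub>2\<^sub>), q\<^sub>(\<^sub>2\<^sub>))\<close>.
\<close>

definition tensor_mult ::
    "('k::field, 'v::ab_group_add) vspace \<Rightarrow> ('k, 'v'::ab_group_add) vspace \<Rightarrow>
     ('k, 'w::ab_group_add) vspace \<Rightarrow> ('k, 'w'::ab_group_add) vspace \<Rightarrow>
     ('k, 'u::ab_group_add) vspace \<Rightarrow> ('k, 'u'::ab_group_add) vspace \<Rightarrow>
     ('v \<Rightarrow> 'w \<Rightarrow> 'u) \<Rightarrow> ('v' \<Rightarrow> 'w' \<Rightarrow> 'u') \<Rightarrow>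
     ('k, 'v, 'v') tensor \<Rightarrow> ('k, 'w, 'w') tensor \<Rightarrow> ('k, 'u, 'u') tensor" where
  "tensor_mult V V' W W' U U' \<beta> \<gamma> p q =
     tensor_lift V V' (\<lambda>v v'.
       tensor_lift W W' (\<lambda>w w'. pure_tensor U U' (\<beta> v w) (\<gamma> v' w')) q) p"

text \<open>The pairing of \<open>V\<^sup>* \<otimes> W\<^sup>*\<close> with \<open>V \<otimes> W\<close>, \<open>\<langle>f \<otimes> g, v \<otimes> w\<rangle> = f(v) g(w)\<close>\<close>

definition tensor_pairing ::
    "('k::field, 'v::ab_group_add) vspace \<Rightarrow> ('k, 'w::ab_group_add) vspace \<Rightarrow>
     ('k, 'v \<Rightarrow> 'k, 'w \<Rightarrow> 'k) tensor \<Rightarrow> ('k, 'v, 'w) tensor \<Rightarrow> 'k" where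
  "tensor_pairing V W \<phi> p =
     tensor_lift (dual_space V) (dual_space W)
       (\<lambda>f g. tensor_lift V W (\<lambda>v w. f v * g w) p) \<phi>"

section \<open>Associative 2-bialgebras\<close>

text \<open>
  \<open>deg0\<close> and \<open>degm1\<close> are the components in degrees 0 and -1. \<open>lact x y\<close> is \<open>x \<cdot> y\<close> and
  \<open>ract y x\<close> is \<open>y \<cdot> x\<close>. \<open>comultm1\<close>, \<open>comult0l\<close>, \<open>comult0r\<close>, \<open>comult0'\<close> are \<open>\<Delta>\<^sub>-\<^sub>1\<close>, \<open>\<Delta>\<^sub>0\<^sup>l\<close>,
  \<open>\<Delta>\<^sub>0\<^sup>r\<close>, \<open>\<Delta>\<^sub>0'\<close>; the map \<open>\<Delta>\<^sub>0 = \<Delta>\<^sub>0\<^sup>l + \<Delta>\<^sub>0\<^sup>r\<close> into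
  \<open>(G\<^sub>-\<^sub>1 \<otimes> G\<^sub>0) \<oplus> (G\<^sub>0 \<otimes> G\<^sub>-\<^sub>1)\<close> is given by its two components.
\<close>

record ('k, 'a, 'b) two_struct =
  deg0 :: "('k, 'a) vspace"
  degm1 :: "('k, 'b) vspace"
  tmap :: "'b \<Rightarrow> 'a"
  mult0 :: "'a \<Rightarrow> 'a \<Rightarrow> 'a"
  multm1 :: "'b \<Rightarrow> 'b \<Rightarrow> 'b"
  lact :: "'a \<Rightarrow> 'b \<Rightarrow> 'b"
  ract :: "'b \<Rightarrow> 'a \<Rightarrow> 'b"
  comultm1 :: "'b \<Rightarrow> ('k, 'b, 'b) tensor"
  comult0l :: "'a \<Rightarrow> ('k, 'b, 'a) tensor"
  comult0r :: "'a \<Rightarrow> ('k, 'a, 'b) tensor"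
  comult0' :: "'a \<Rightarrow> ('k, 'a, 'a) tensor"

definition two_algebra_data ::
    "('k::field, 'a::ab_group_add, 'b::ab_group_add) two_struct \<Rightarrow> bool" where
  "two_algebra_data G \<longleftrightarrow>
     fin_dim_vspace (deg0 G) \<and> fin_dim_vspace (degm1 G) \<and>
     linear_between (degm1 G) (deg0 G) (tmap G) \<and>
     bilinear_between (deg0 G) (deg0 G) (deg0 G) (mult0 G) \<and>
     bilinear_between (degm1 G) (degm1 G) (degm1 G) (multm1 G) \<and>
     bilinear_between (deg0 G) (degm1 G) (degm1 G) (lact G) \<and>
     bilinear_between (degm1 G) (deg0 G) (degm1 G) (ract G)"

definition two_coalgebra_data ::
    "('k::field, 'a::ab_group_add, 'b::ab_group_add) two_struct \<Rightarrow> bool" where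
  "two_coalgebra_data G \<longleftrightarrow>
     fin_dim_vspace (deg0 G) \<and> fin_dim_vspace (degm1 G) \<and>
     linear_between (degm1 G) (deg0 G) (tmap G) \<and>
     linear_between (degm1 G) (tensor_space (degm1 G) (degm1 G)) (comultm1 G) \<and>
     linear_between (deg0 G) (tensor_space (degm1 G) (deg0 G)) (comult0l G) \<and>
     linear_between (deg0 G) (tensor_space (deg0 G) (degm1 G)) (comult0r G) \<and>
     linear_between (deg0 G) (tensor_space (deg0 G) (deg0 G)) (comult0' G)"

definition associative_2_algebra ::
    "('k::field, 'a::ab_group_add, 'b::ab_group_add) two_struct \<Rightarrow> bool" where
  "associative_2_algebra G \<longleftrightarrow>
     two_algebra_data G \<and>
     (\<forall>x\<in>vcarrier (deg0 G). \<forall>x'\<in>vcarrier (deg0 G). \<forall>x''\<in>vcarrier (deg0 G).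
        mult0 G (mult0 G x x') x'' = mult0 G x (mult0 G x' x'')) \<and>
     (\<forall>y\<in>vcarrier (degm1 G). \<forall>y'\<in>vcarrier (degm1 G). \<forall>y''\<in>vcarrier (degm1 G).
        multm1 G (multm1 G y y') y'' = multm1 G y (multm1 G y' y'')) \<and>
     (\<forall>y\<in>vcarrier (degm1 G). \<forall>y'\<in>vcarrier (degm1 G).
        tmap G (multm1 G y y') = mult0 G (tmap G y) (tmap G y')) \<and>
     (\<forall>x\<in>vcarrier (deg0 G). \<forall>x'\<in>vcarrier (deg0 G). \<forall>y\<in>vcarrier (degm1 G).
        lact G (mult0 G x' x) y = lact G x' (lact G x y) \<and>
        ract G (lact G x y) x' = lact G x (ract G y x') \<and>
        ract G y (mult0 G x x') = ract G (ract G y x) x') \<and>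
     (\<forall>x\<in>vcarrier (deg0 G). \<forall>y\<in>vcarrier (degm1 G).
        tmap G (lact G x y) = mult0 G x (tmap G y) \<and>
        tmap G (ract G y x) = mult0 G (tmap G y) x) \<and>
     (\<forall>y\<in>vcarrier (degm1 G). \<forall>y'\<in>vcarrier (degm1 G).
        lact G (tmap G y) y' = multm1 G y y' \<and>
        ract G y (tmap G y') = multm1 G y y')"

definition coassociative_2_coalgebra ::
    "('k::field, 'a::ab_group_add, 'b::ab_group_add) two_struct \<Rightarrow> bool" where
  "coassociative_2_coalgebra G \<longleftrightarrow>
     two_coalgebra_data G \<and>
     (let V0 = deg0 G; V1 = degm1 G;
          \<Delta>1 = comultm1 G; \<Delta>l = comult0l G; \<Delta>r = comult0r G; \<Delta>' = comult0' G
      in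
       (\<forall>y\<in>vcarrier V1.
          tensor_assoc V1 V1 V1 (tensor_map V1 V1 (tensor_space V1 V1) V1 \<Delta>1 id (\<Delta>1 y)) =
          tensor_map V1 V1 V1 (tensor_space V1 V1) id \<Delta>1 (\<Delta>1 y)) \<and>
       (\<forall>x\<in>vcarrier V0.
          tensor_assoc V0 V0 V0 (tensor_map V0 V0 (tensor_space V0 V0) V0 \<Delta>' id (\<Delta>' x)) =
          tensor_map V0 V0 V0 (tensor_space V0 V0) id \<Delta>' (\<Delta>' x)) \<and>
       (\<forall>x\<in>vcarrier V0.
          tensor_assoc V1 V1 V0 (tensor_map V1 V0 (tensor_space V1 V1) V0 \<Delta>1 id (\<Delta>l x)) =
          tensor_map V1 V0 V1 (tensor_space V1 V0) id \<Delta>l (\<Delta>l x)) \<and>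
       (\<forall>x\<in>vcarrier V0.
          tensor_map V0 V1 V0 (tensor_space V1 V1) id \<Delta>1 (\<Delta>r x) =
          tensor_assoc V0 V1 V1 (tensor_map V0 V1 (tensor_space V0 V1) V1 \<Delta>r id (\<Delta>r x))) \<and>
       (\<forall>x\<in>vcarrier V0.
          tensor_map V1 V0 V1 (tensor_space V0 V1) id \<Delta>r (\<Delta>l x) =
          tensor_assoc V1 V0 V1 (tensor_map V0 V1 (tensor_space V1 V0) V1 \<Delta>l id (\<Delta>r x))) \<and>
       (\<forall>y\<in>vcarrier V1. \<Delta>' (tmap G y) = tensor_map V1 V1 V0 V0 (tmap G) (tmap G) (\<Delta>1 y)) \<and>
       (\<comment> \<open>the two components of \<open>(t \<otimes> 1 + 1 \<otimes> t) \<Delta>\<^sub>-\<^sub>1 = \<Delta>\<^sub>0 t\<close>\<close>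
        \<forall>y\<in>vcarrier V1.
          tensor_map V1 V1 V0 V1 (tmap G) id (\<Delta>1 y) = \<Delta>r (tmap G y) \<and>
          tensor_map V1 V1 V1 V0 id (tmap G) (\<Delta>1 y) = \<Delta>l (tmap G y)) \<and>
       (\<forall>x\<in>vcarrier V0.
          tensor_map V1 V0 V0 V0 (tmap G) id (\<Delta>l x) = \<Delta>' x \<and>
          tensor_map V0 V1 V0 V0 id (tmap G) (\<Delta>r x) = \<Delta>' x))"

definition associative_2_bialgebra ::
    "('k::field, 'a::ab_group_add, 'b::ab_group_add) two_struct \<Rightarrow> bool" where
  "associative_2_bialgebra G \<longleftrightarrow>
     associative_2_algebra G \<and> coassociative_2_coalgebra G \<and>
     (let V0 = deg0 G; V1 = degm1 G;
          \<Delta>1 = comultm1 G; \<Delta>l = comult0l G; \<Delta>r = comult0r G; \<Delta>' = comult0' G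
      in
       (\<forall>x\<in>vcarrier V0. \<forall>y\<in>vcarrier V1.
          \<Delta>1 (lact G x y) = tensor_mult V0 V0 V1 V1 V1 V1 (lact G) (lact G) (\<Delta>' x) (\<Delta>1 y) \<and>
          \<Delta>1 (ract G y x) = tensor_mult V1 V1 V0 V0 V1 V1 (ract G) (ract G) (\<Delta>1 y) (\<Delta>' x)) \<and>
       (\<forall>x\<in>vcarrier V0. \<forall>x'\<in>vcarrier V0.
          \<Delta>l (mult0 G x x') = tensor_mult V1 V0 V1 V0 V1 V0 (multm1 G) (mult0 G) (\<Delta>l x) (\<Delta>l x') \<and>
          \<Delta>r (mult0 G x x') = tensor_mult V0 V1 V0 V1 V0 V1 (mult0 G) (multm1 G) (\<Delta>r x) (\<Delta>r x')))"

text \<open>Units \<open>\<eta>\<^sub>0, \<eta>\<^sub>-\<^sub>1\<close> and counits \<open>\<epsilon>\<^sub>0, \<epsilon>\<^sub>-\<^sub>1\<close>\<close>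

record ('k, 'a, 'b) two_units =
  unit0 :: 'a
  unitm1 :: 'b
  counit0 :: "'a \<Rightarrow> 'k"
  counitm1 :: "'b \<Rightarrow> 'k"

definition two_units_data ::
    "('k::field, 'a::ab_group_add, 'b::ab_group_add) two_struct \<Rightarrow>
     ('k, 'a, 'b) two_units \<Rightarrow> bool" where
  "two_units_data G u \<longleftrightarrow>
     unit0 u \<in> vcarrier (deg0 G) \<and> unitm1 u \<in> vcarrier (degm1 G) \<and>
     linear_between (deg0 G) ground (counit0 u) \<and> linear_between (degm1 G) ground (counitm1 u)"

definition unital_2_algebra ::
    "('k::field, 'a::ab_group_add, 'b::ab_group_add) two_struct \<Rightarrow>
     ('k, 'a, 'b) two_units \<Rightarrow> bool" where
  "unital_2_algebra G u \<longleftrightarrow>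
     (\<forall>x\<in>vcarrier (deg0 G). mult0 G (unit0 u) x = x \<and> mult0 G x (unit0 u) = x) \<and>
     (\<forall>y\<in>vcarrier (degm1 G). multm1 G (unitm1 u) y = y \<and> multm1 G y (unitm1 u) = y) \<and>
     tmap G (unitm1 u) = unit0 u \<and>
     (\<forall>y\<in>vcarrier (degm1 G). lact G (unit0 u) y = y \<and> ract G y (unit0 u) = y)"

definition counital_2_coalgebra ::
    "('k::field, 'a::ab_group_add, 'b::ab_group_add) two_struct \<Rightarrow>
     ('k, 'a, 'b) two_units \<Rightarrow> bool" where
  "counital_2_coalgebra G u \<longleftrightarrow>
     (let V0 = deg0 G; V1 = degm1 G; \<epsilon>0 = counit0 u; \<epsilon>1 = counitm1 u
      in
       (\<forall>y\<in>vcarrier V1.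
          tensor_lift V1 V1 (\<lambda>y1 y2. vscale V1 (\<epsilon>1 y2) y1) (comultm1 G y) = y \<and>
          tensor_lift V1 V1 (\<lambda>y1 y2. vscale V1 (\<epsilon>1 y1) y2) (comultm1 G y) = y) \<and>
       (\<forall>x\<in>vcarrier V0.
          tensor_lift V1 V0 (\<lambda>y1 x2. vscale V0 (\<epsilon>1 y1) x2) (comult0l G x) = x \<and>
          tensor_lift V0 V1 (\<lambda>x1 y2. vscale V0 (\<epsilon>1 y2) x1) (comult0r G x) = x) \<and>
       (\<forall>y\<in>vcarrier V1. \<epsilon>1 y = \<epsilon>0 (tmap G y)) \<and>
       (\<forall>x\<in>vcarrier V0.
          tensor_lift V0 V0 (\<lambda>x1 x2. vscale V0 (\<epsilon>0 x1) x2) (comult0' G x) = x \<and>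
          tensor_lift V0 V0 (\<lambda>x1 x2. vscale V0 (\<epsilon>0 x2) x1) (comult0' G x) = x))"

definition unital_associative_2_bialgebra ::
    "('k::field, 'a::ab_group_add, 'b::ab_group_add) two_struct \<Rightarrow>
     ('k, 'a, 'b) two_units \<Rightarrow> bool" where
  "unital_associative_2_bialgebra G u \<longleftrightarrow>
     associative_2_bialgebra G \<and> two_units_data G u \<and>
     unital_2_algebra G u \<and> counital_2_coalgebra G u"

section \<open>The dual structure\<close>

text \<open>
  For a comultiplication \<open>\<Delta> : U \<rightarrow> V \<otimes> W\<close>, the product \<open>V\<^sup>* \<times> W\<^sup>* \<rightarrow> U\<^sup>*\<close> with
  \<open>\<langle>f f', u\<rangle> = \<langle>f \<otimes> f', \<Delta> u\<rangle>\<close>.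
\<close>

definition dual_mult ::
    "('k::field, 'u::ab_group_add) vspace \<Rightarrow> ('k, 'v::ab_group_add) vspace \<Rightarrow>
     ('k, 'w::ab_group_add) vspace \<Rightarrow> ('u \<Rightarrow> ('k, 'v, 'w) tensor) \<Rightarrow>
     ('v \<Rightarrow> 'k) \<Rightarrow> ('w \<Rightarrow> 'k) \<Rightarrow> 'u \<Rightarrow> 'k" where
  "dual_mult U V W \<Delta> f f' =
     restrict0 U
       (\<lambda>u. tensor_pairing V W (pure_tensor (dual_space V) (dual_space W) f f') (\<Delta> u))"

text \<open>
  For a product \<open>\<mu> : V \<times> W \<rightarrow> U\<close>, the comultiplication \<open>U\<^sup>* \<rightarrow> V\<^sup>* \<otimes> W\<^sup>*\<close> with
  \<open>\<langle>\<Delta> f, v \<otimes> w\<rangle> = \<langle>f, \<mu>(v, w)\<rangle>\<close>, which exists and is unique for finite-dimensional \<open>V\<close> and \<open>W\<close>.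
\<close>

definition dual_comult ::
    "('k::field, 'v::ab_group_add) vspace \<Rightarrow> ('k, 'w::ab_group_add) vspace \<Rightarrow>
     ('v \<Rightarrow> 'w \<Rightarrow> 'u) \<Rightarrow> ('u \<Rightarrow> 'k) \<Rightarrow> ('k, 'v \<Rightarrow> 'k, 'w \<Rightarrow> 'k) tensor" where
  "dual_comult V W \<mu> f =
     (THE \<phi>. \<phi> \<in> vcarrier (tensor_space (dual_space V) (dual_space W)) \<and>
        (\<forall>v\<in>vcarrier V. \<forall>w\<in>vcarrier W.
           tensor_pairing V W \<phi> (pure_tensor V W v w) = f (\<mu> v w)))"

definition dual_2_struct ::
    "('k::field, 'a::ab_group_add, 'b::ab_group_add) two_struct \<Rightarrow>
     ('k, 'b \<Rightarrow> 'k, 'a \<Rightarrow> 'k) two_struct" where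
  "dual_2_struct G =
     \<lparr>deg0 = dual_space (degm1 G),
      degm1 = dual_space (deg0 G),
      tmap = (\<lambda>g. restrict0 (degm1 G) (\<lambda>y. g (tmap G y))),
      mult0 = dual_mult (degm1 G) (degm1 G) (degm1 G) (comultm1 G),
      multm1 = dual_mult (deg0 G) (deg0 G) (deg0 G) (comult0' G),
      lact = dual_mult (deg0 G) (degm1 G) (deg0 G) (comult0l G),
      ract = dual_mult (deg0 G) (deg0 G) (degm1 G) (comult0r G),
      comultm1 = dual_comult (deg0 G) (deg0 G) (mult0 G),
      comult0l = dual_comult (deg0 G) (degm1 G) (lact G),
      comult0r = dual_comult (degm1 G) (deg0 G) (ract G),
      comult0' = dual_comult (degm1 G) (degm1 G) (multm1 G)\<rparr>"

definition dual_2_units ::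
    "('k::field, 'a::ab_group_add, 'b::ab_group_add) two_struct \<Rightarrow>
     ('k, 'a, 'b) two_units \<Rightarrow> ('k, 'b \<Rightarrow> 'k, 'a \<Rightarrow> 'k) two_units" where
  "dual_2_units G u =
     \<lparr>unit0 = restrict0 (degm1 G) (counitm1 u),
      unitm1 = restrict0 (deg0 G) (counit0 u),
      counit0 = (\<lambda>f. f (unitm1 u)),
      counitm1 = (\<lambda>g. g (unit0 u))\<rparr>"

end

(* An element p of V \<otimes> W is by construction a function on V* \<times> W*, with p f g = \<langle>f \<otimes> g, p\<rangle>. Evaluating an
   identity between tensors at all functionals therefore turns each coalgebra axiom of G into the
   corresponding algebra axiom of G*, and, through the canonical isomorphism of G with G**, each
   algebra axiom of G into a coalgebra axiom of G*. The compatibility conditions are exchanged among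
   themselves, those for the actions with those for the product of G_0: written out in dual bases, both
   sides of a condition and of its transpose are the same sums of products of structure constants. *)
theory Submission
  imports Defs
begin

text \<open>Only one transposition of axioms is carried out: coalgebra axioms of G against algebra
  axioms of G*. Applied to G* itself, it equates the coalgebra axioms of G* with the algebra axioms
  of G**, so along the canonical map only products, actions, t and units have to be transported; the
  comultiplications of G** are never computed. The compatibility conditions need no bidual: each
  says that a comultiplication of a product is a product of comultiplications, a shape that
  transposition preserves up to interchanging the two inner tensor factors.

  The encoding shapes the rest. A functional must vanish off its carrier to be a legitimate argument
  of a tensor, so transposes appear wrapped in \<open>restrict0\<close>; in exchange, equality of
  functionals and of tensors, as functions, is decided on carriers. Since \<open>tensor_lift\<close>
  sums over an arbitrarily chosen list, it must first be shown to depend on the tensor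
  alone.\<close>

lemma sum_fun_apply: "(\<Sum>i\<in>A. f i) x = (\<Sum>i\<in>A. f i x)"
  for f :: "'i \<Rightarrow> 'c \<Rightarrow> 'd::comm_monoid_add"
  by (induction A rule: infinite_finite_induct) auto

section \<open>Finite-dimensional spaces and dual bases\<close>

lemma fin_dim_vector_space: "fin_dim_vspace V \<Longrightarrow> vector_space (vscale V)"
  by (simp add: fin_dim_vspace_def)

lemma fin_dim_subspace:
  assumes "fin_dim_vspace V" shows "module.subspace (vscale V) (vcarrier V)"
proof -
  interpret vector_space "vscale V" using assms by (rule fin_dim_vector_space)
  show ?thesis using assms subspace_span by (auto simp: fin_dim_vspace_def)
qed

lemma
  assumes "fin_dim_vspace V"
  shows fin_dim_zero [simp]: "0 \<in> vcarrier V"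
    and fin_dim_add [simp]: "\<lbrakk>v \<in> vcarrier V; w \<in> vcarrier V\<rbrakk> \<Longrightarrow> v + w \<in> vcarrier V"
    and fin_dim_scale [simp]: "v \<in> vcarrier V \<Longrightarrow> vscale V c v \<in> vcarrier V"
    and fin_dim_sum: "(\<And>i. i \<in> A \<Longrightarrow> x i \<in> vcarrier V) \<Longrightarrow> (\<Sum>i\<in>A. x i) \<in> vcarrier V"
proof -
  interpret vector_space "vscale V" using assms by (rule fin_dim_vector_space)
  note S = fin_dim_subspace[OF assms]
  show "0 \<in> vcarrier V" using S by (rule subspace_0)
  show "\<lbrakk>v \<in> vcarrier V; w \<in> vcarrier V\<rbrakk> \<Longrightarrow> v + w \<in> vcarrier V" using S by (rule subspace_add)
  show "v \<in> vcarrier V \<Longrightarrow> vscale V c v \<in> vcarrier V" using S by (rule subspace_scale)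
  show "(\<And>i. i \<in> A \<Longrightarrow> x i \<in> vcarrier V) \<Longrightarrow> (\<Sum>i\<in>A. x i) \<in> vcarrier V" using S by (rule subspace_sum)
qed

lemma vscale_simps:
  assumes "fin_dim_vspace V"
  shows "vscale V a (v + w) = vscale V a v + vscale V a w"
    and "vscale V (a + b) v = vscale V a v + vscale V b v"
    and "vscale V a (vscale V b v) = vscale V (a * b) v"
    and "vscale V 0 v = 0" and "vscale V a 0 = 0" and "vscale V 1 v = v"
    and "vscale V a (sum x A) = (\<Sum>i\<in>A. vscale V a (x i))"
    and "vscale V (sum c A) v = (\<Sum>i\<in>A. vscale V (c i) v)"
proof -
  interpret vector_space "vscale V" using assms by (rule fin_dim_vector_space)
  show "vscale V a (v + w) = vscale V a v + vscale V a w" by (rule scale_right_distrib)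
  show "vscale V (a + b) v = vscale V a v + vscale V b v" by (rule scale_left_distrib)
  show "vscale V a (vscale V b v) = vscale V (a * b) v" "vscale V 0 v = 0" "vscale V a 0 = 0"
    "vscale V 1 v = v" by simp_all
  show "vscale V a (sum x A) = (\<Sum>i\<in>A. vscale V a (x i))" by (rule scale_sum_right)
  show "vscale V (sum c A) v = (\<Sum>i\<in>A. vscale V (c i) v)" by (rule scale_sum_left)
qed

section \<open>Linear and bilinear maps on carriers\<close>

lemma linear_betweenI:
  assumes "\<And>v. v \<in> vcarrier V \<Longrightarrow> T v \<in> vcarrier W"
    and "\<And>v v'. \<lbrakk>v \<in> vcarrier V; v' \<in> vcarrier V\<rbrakk> \<Longrightarrow> T (v + v') = T v + T v'"
    and "\<And>c v. v \<in> vcarrier V \<Longrightarrow> T (vscale V c v) = vscale W c (T v)"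
  shows "linear_between V W T"
  using assms by (simp add: linear_between_def)

lemma linear_between_in: "\<lbrakk>linear_between V W T; v \<in> vcarrier V\<rbrakk> \<Longrightarrow> T v \<in> vcarrier W"
  by (simp add: linear_between_def)

lemma linear_between_add:
  "\<lbrakk>linear_between V W T; v \<in> vcarrier V; v' \<in> vcarrier V\<rbrakk> \<Longrightarrow> T (v + v') = T v + T v'"
  by (simp add: linear_between_def)

lemma linear_between_scale:
  "\<lbrakk>linear_between V W T; v \<in> vcarrier V\<rbrakk> \<Longrightarrow> T (vscale V c v) = vscale W c (T v)"
  by (simp add: linear_between_def)

lemma linear_between_zero: "fin_dim_vspace V \<Longrightarrow> linear_between V W T \<Longrightarrow> T 0 = 0"
  using linear_between_add[of V W T 0 0] by simp

lemma linear_between_sum: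
  assumes "fin_dim_vspace V" "linear_between V W T" "\<And>i. i \<in> A \<Longrightarrow> x i \<in> vcarrier V"
  shows "T (\<Sum>i\<in>A. x i) = (\<Sum>i\<in>A. T (x i))"
  using assms(3)
  by (induction A rule: infinite_finite_induct)
     (auto simp: linear_between_zero[OF assms(1,2)] linear_between_add[OF assms(2)] fin_dim_sum[OF assms(1)])

lemma linear_between_lincomb:
  assumes "fin_dim_vspace V" "linear_between V W T" "\<And>i. i \<in> A \<Longrightarrow> x i \<in> vcarrier V"
  shows "T (\<Sum>i\<in>A. vscale V (c i) (x i)) = (\<Sum>i\<in>A. vscale W (c i) (T (x i)))"
  using assms by (simp add: linear_between_sum[OF assms(1,2)] linear_between_scale[OF assms(2)] cong: sum.cong)

lemma linear_between_id [simp]: "linear_between V V id" "linear_between V V (\<lambda>x. x)"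
  by (simp_all add: linear_between_def)

lemma linear_between_compose:
  "\<lbrakk>linear_between U V S; linear_between V W T\<rbrakk> \<Longrightarrow> linear_between U W (\<lambda>u. T (S u))"
  by (simp add: linear_between_def)

lemma linear_between_cong:
  assumes "linear_between V W S" "fin_dim_vspace V" "\<And>v. v \<in> vcarrier V \<Longrightarrow> T v = S v"
  shows "linear_between V W T"
  using assms by (simp add: linear_between_def)

lemma bilinear_betweenI:
  assumes "\<And>u. u \<in> vcarrier U \<Longrightarrow> linear_between V W (\<beta> u)"
    and "\<And>v. v \<in> vcarrier V \<Longrightarrow> linear_between U W (\<lambda>u. \<beta> u v)"
  shows "bilinear_between U V W \<beta>"
  using assms by (simp add: bilinear_between_def)

lemma bilinear_between_right: "\<lbrakk>bilinear_between U V W \<beta>; u \<in> vcarrier U\<rbrakk> \<Longrightarrow> linear_between V W (\<beta> u)"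
  and bilinear_between_left: "\<lbrakk>bilinear_between U V W \<beta>; v \<in> vcarrier V\<rbrakk> \<Longrightarrow> linear_between U W (\<lambda>u. \<beta> u v)"
  by (simp_all add: bilinear_between_def)

lemma bilinear_between_in:
  "\<lbrakk>bilinear_between U V W \<beta>; u \<in> vcarrier U; v \<in> vcarrier V\<rbrakk> \<Longrightarrow> \<beta> u v \<in> vcarrier W"
  by (meson bilinear_between_right linear_between_in)

lemma bilinear_between_compose:
  assumes "bilinear_between U V W \<beta>" "linear_between W X T"
  shows "bilinear_between U V X (\<lambda>u v. T (\<beta> u v))"
  using assms by (auto simp: bilinear_between_def intro: linear_between_compose)

lemma ground_simps [simp]: "vcarrier ground = UNIV" "vscale ground = (*)"
  by (simp_all add: ground_def)

lemma fin_dim_ground [simp]: "fin_dim_vspace (ground :: ('k::field, 'k) vspace)"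
proof -
  interpret vector_space "(*) :: 'k \<Rightarrow> 'k \<Rightarrow> 'k" by unfold_locales (auto simp: algebra_simps)
  have "x \<in> span {1}" for x :: 'k using span_scale[of 1 "{1}" x] by (simp add: span_base)
  then have "UNIV = span {1::'k}" by auto
  then show ?thesis using vector_space_axioms by (auto simp: fin_dim_vspace_def intro!: exI[of _ "{1}"])
qed

section \<open>Dual spaces\<close>

lemma dual_space_carrier:
  "f \<in> vcarrier (dual_space V) \<longleftrightarrow> linear_between V ground f \<and> (\<forall>v. v \<notin> vcarrier V \<longrightarrow> f v = 0)"
  by (simp add: dual_space_def)

lemma vscale_dual_space [simp]: "vscale (dual_space V) c f = (\<lambda>v. c * f v)"
  by (simp add: dual_space_def)

lemma dual_linear: "f \<in> vcarrier (dual_space V) \<Longrightarrow> linear_between V ground f"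
  by (simp add: dual_space_carrier)

lemma dual_outside: "\<lbrakk>f \<in> vcarrier (dual_space V); v \<notin> vcarrier V\<rbrakk> \<Longrightarrow> f v = 0"
  by (simp add: dual_space_carrier)

lemma dual_eqI:
  assumes "f \<in> vcarrier (dual_space V)" "g \<in> vcarrier (dual_space V)"
    and "\<And>v. v \<in> vcarrier V \<Longrightarrow> f v = g v"
  shows "f = g"
  using assms by (metis dual_outside ext)

lemma dual_lincomb:
  assumes "fin_dim_vspace V" "f \<in> vcarrier (dual_space V)" "\<And>i. i \<in> A \<Longrightarrow> x i \<in> vcarrier V"
  shows "f (\<Sum>i\<in>A. vscale V (c i) (x i)) = (\<Sum>i\<in>A. c i * f (x i))"
  using linear_between_lincomb[OF assms(1) dual_linear[OF assms(2)] assms(3)] by simp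

lemma restrict0_in [simp]: "v \<in> vcarrier V \<Longrightarrow> restrict0 V f v = f v"
  and restrict0_out: "v \<notin> vcarrier V \<Longrightarrow> restrict0 V f v = 0"
  by (simp_all add: restrict0_def)

lemma restrict0_cong: "(\<And>v. v \<in> vcarrier V \<Longrightarrow> f v = g v) \<Longrightarrow> restrict0 V f = restrict0 V g"
  by (auto simp: restrict0_def)

lemma restrict0_dual: "f \<in> vcarrier (dual_space V) \<Longrightarrow> restrict0 V f = f"
  by (auto simp: restrict0_def fun_eq_iff dual_outside)

lemma restrict0_in_dual:
  "\<lbrakk>fin_dim_vspace V; linear_between V ground f\<rbrakk> \<Longrightarrow> restrict0 V f \<in> vcarrier (dual_space V)"
  by (auto simp: dual_space_carrier restrict0_out intro: linear_between_cong)

text \<open>Only the reproduction of vectors from their coordinates is asked for, not that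
  \<open>e b (x c)\<close> is a Kronecker delta: the expansions below rest on this property.
  Indexing by naturals keeps the index type independent of the type of vectors.\<close>

definition dual_basis ::
    "('k::field, 'v::ab_group_add) vspace \<Rightarrow> nat set \<Rightarrow> (nat \<Rightarrow> 'v) \<Rightarrow> (nat \<Rightarrow> 'v \<Rightarrow> 'k) \<Rightarrow> bool" where
  "dual_basis V B x e \<longleftrightarrow> finite B \<and> (\<forall>b\<in>B. x b \<in> vcarrier V) \<and> (\<forall>b\<in>B. e b \<in> vcarrier (dual_space V)) \<and>
     (\<forall>v\<in>vcarrier V. v = (\<Sum>b\<in>B. vscale V (e b v) (x b)))"

lemma dual_basisD:
  assumes "dual_basis V B x e"
  shows "finite B" and "b \<in> B \<Longrightarrow> x b \<in> vcarrier V" and "b \<in> B \<Longrightarrow> e b \<in> vcarrier (dual_space V)"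
    and "v \<in> vcarrier V \<Longrightarrow> (\<Sum>b\<in>B. vscale V (e b v) (x b)) = v"
  using assms by (auto simp: dual_basis_def)

lemma dual_basis_exists:
  assumes "fin_dim_vspace V" shows "\<exists>B x e. dual_basis V B x e"
proof -
  interpret vector_space "vscale V" using assms by (rule fin_dim_vector_space)
  obtain S where S: "finite S" "vcarrier V = span S" using assms by (auto simp: fin_dim_vspace_def)
  obtain B where B: "B \<subseteq> S" "independent B" "S \<subseteq> span B" using maximal_independent_subset by blast
  have fin: "finite B" using B S finite_subset by blast
  have V: "vcarrier V = span B"
    using B S by (metis span_mono span_span subset_antisym)
  \<comment> \<open>Coordinate functionals of the basis, in the form that \<open>dual_space\<close>
    demands: zero off the carrier.\<close>
  define e where "e b = restrict0 V (\<lambda>v. representation B v b)" for b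
  have e: "e b \<in> vcarrier (dual_space V)" for b
    unfolding e_def
    by (intro restrict0_in_dual assms linear_betweenI)
       (auto simp: V representation_add representation_scale B)
  have expand: "(\<Sum>b\<in>B. vscale V (e b v) b) = v" if "v \<in> vcarrier V" for v
    using that fin B by (simp add: e_def V sum_representation_eq)
  obtain h where h: "bij_betw h {0..<card B} B" using ex_bij_betw_nat_finite[OF fin] by blast
  have "dual_basis V {0..<card B} h (\<lambda>i. e (h i))"
    unfolding dual_basis_def
  proof (intro conjI ballI)
    fix i assume "i \<in> {0..<card B}"
    then show "h i \<in> vcarrier V" using h span_superset[of B] V by (auto simp: bij_betw_def)
  next
    fix v assume "v \<in> vcarrier V"
    then show "v = (\<Sum>i = 0..<card B. vscale V (e (h i) v) (h i))"
      using expand sum.reindex_bij_betw[OF h, of "\<lambda>b. vscale V (e b v) b"] by simp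
  qed (simp_all add: e)
  then show ?thesis by blast
qed

lemma dual_basis_apply:
  assumes "fin_dim_vspace V" "dual_basis V B x e" "f \<in> vcarrier (dual_space V)" "v \<in> vcarrier V"
  shows "f v = (\<Sum>b\<in>B. e b v * f (x b))"
proof -
  have "f v = f (\<Sum>b\<in>B. vscale V (e b v) (x b))" using assms(4) dual_basisD(4)[OF assms(2)] by simp
  also have "\<dots> = (\<Sum>b\<in>B. e b v * f (x b))"
    by (intro dual_lincomb assms dual_basisD(2)[OF assms(2)])
  finally show ?thesis .
qed

text \<open>The coordinates of \<open>f\<close> are its values on the basis vectors. The identity is
  one of functions, so it also has to hold off the carrier, where all terms vanish.\<close>

lemma dual_expand:
  assumes "fin_dim_vspace V" "dual_basis V B x e" "f \<in> vcarrier (dual_space V)"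
  shows "f = (\<Sum>b\<in>B. vscale (dual_space V) (f (x b)) (e b))"
proof
  fix v show "f v = (\<Sum>b\<in>B. vscale (dual_space V) (f (x b)) (e b)) v"
  proof (cases "v \<in> vcarrier V")
    case True
    then show ?thesis using dual_basis_apply[OF assms True] by (simp add: sum_fun_apply mult.commute)
  next
    case False
    then show ?thesis
      by (simp add: sum_fun_apply dual_outside[OF assms(3)] dual_outside[OF dual_basisD(3)[OF assms(2)]])
  qed
qed

lemma vector_space_funcs: "vector_space (\<lambda>c f x. c * f x :: 'k::field)"
  by unfold_locales (auto simp: fun_eq_iff algebra_simps)

lemma fin_dim_dual [simp]:
  assumes "fin_dim_vspace V" shows "fin_dim_vspace (dual_space V)"
proof -
  obtain B x e where B: "dual_basis V B x e" using dual_basis_exists assms by blast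
  interpret vector_space "vscale (dual_space V)" unfolding vscale_dual_space by (rule vector_space_funcs)
  have sub: "subspace (vcarrier (dual_space V))"
    by (rule subspaceI)
      (auto simp: dual_space_carrier linear_between_def algebra_simps)
  have "e ` B \<subseteq> vcarrier (dual_space V)" using dual_basisD(3)[OF B] by blast
  then have "span (e ` B) \<subseteq> vcarrier (dual_space V)" by (rule span_minimal) (rule sub)
  moreover have "f \<in> span (e ` B)" if "f \<in> vcarrier (dual_space V)" for f
    by (subst dual_expand[OF assms B that]) (intro span_sum span_scale span_base imageI)
  ultimately have "vcarrier (dual_space V) = span (e ` B)" by blast
  moreover have "finite (e ` B)" using dual_basisD(1)[OF B] by simp
  ultimately show ?thesis using vector_space_axioms by (auto simp: fin_dim_vspace_def)
qed

text \<open>The coordinates \<open>e b\<close> are themselves functionals, so two vectors on which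
  all functionals agree have equal coordinates.\<close>

lemma dual_separates:
  assumes "fin_dim_vspace V" "v \<in> vcarrier V" "w \<in> vcarrier V"
    and "\<And>f. f \<in> vcarrier (dual_space V) \<Longrightarrow> f v = f w"
  shows "v = w"
proof -
  obtain B x e where B: "dual_basis V B x e" using dual_basis_exists assms by blast
  have "(\<Sum>b\<in>B. vscale V (e b v) (x b)) = (\<Sum>b\<in>B. vscale V (e b w) (x b))"
    by (intro sum.cong refl) (simp add: assms(4) dual_basisD(3)[OF B])
  then show ?thesis using dual_basisD(4)[OF B] assms(2,3) by simp
qed

section \<open>Biduality\<close>

definition dual_eval :: "('k::field, 'v::ab_group_add) vspace \<Rightarrow> 'v \<Rightarrow> ('v \<Rightarrow> 'k) \<Rightarrow> 'k" where
  "dual_eval V v = restrict0 (dual_space V) (\<lambda>f. f v)"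

lemma dual_eval_apply [simp]: "f \<in> vcarrier (dual_space V) \<Longrightarrow> dual_eval V v f = f v"
  by (simp add: dual_eval_def)

lemma dual_eval_in [simp]:
  assumes "fin_dim_vspace V" "v \<in> vcarrier V"
  shows "dual_eval V v \<in> vcarrier (dual_space (dual_space V))"
  unfolding dual_eval_def using assms
  by (intro restrict0_in_dual linear_betweenI) auto

lemma dual_eval_inject:
  assumes "fin_dim_vspace V" "v \<in> vcarrier V" "w \<in> vcarrier V"
  shows "dual_eval V v = dual_eval V w \<longleftrightarrow> v = w"
  using dual_separates[OF assms] by (metis dual_eval_apply)

lemma dual_dual_carrier:
  assumes V: "fin_dim_vspace V"
  shows "vcarrier (dual_space (dual_space V)) = dual_eval V ` vcarrier V"
proof
  show "dual_eval V ` vcarrier V \<subseteq> vcarrier (dual_space (dual_space V))" using V by auto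
  show "vcarrier (dual_space (dual_space V)) \<subseteq> dual_eval V ` vcarrier V"
  proof
    fix F assume F: "F \<in> vcarrier (dual_space (dual_space V))"
    obtain B x e where B: "dual_basis V B x e" using dual_basis_exists V by blast
    \<comment> \<open>The preimage of \<open>F\<close>: its coordinates have to be the values of
      \<open>F\<close> on the coordinate functionals.\<close>
    define v where "v = (\<Sum>b\<in>B. vscale V (F (e b)) (x b))"
    have v: "v \<in> vcarrier V" unfolding v_def using V dual_basisD(2)[OF B] by (intro fin_dim_sum) auto
    have "F = dual_eval V v"
    proof (rule dual_eqI[OF F dual_eval_in[OF V v]])
      fix f assume f: "f \<in> vcarrier (dual_space V)"
      have "f v = (\<Sum>b\<in>B. F (e b) * f (x b))"
        unfolding v_def by (intro dual_lincomb V f dual_basisD(2)[OF B])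
      moreover have "F f = (\<Sum>b\<in>B. f (x b) * F (e b))"
        using dual_lincomb[OF fin_dim_dual[OF V] F, of B e "\<lambda>b. f (x b)"] dual_basisD(3)[OF B] dual_expand[OF V B f]
        by simp
      ultimately show "F f = dual_eval V v f" using f by (simp add: mult.commute)
    qed
    then show "F \<in> dual_eval V ` vcarrier V" using v by blast
  qed
qed

text \<open>Lets a sum over structure constants of the duals run over the same indices as one over
  those of the original spaces; \<open>compatible_iff\<close> compares its two sides in this
  way.\<close>

lemma dual_basis_dual:
  assumes "fin_dim_vspace V" "dual_basis V B x e"
  shows "dual_basis (dual_space V) B e (\<lambda>b. dual_eval V (x b))"
proof -
  have "f = (\<Sum>b\<in>B. vscale (dual_space V) (dual_eval V (x b) f) (e b))"
    if "f \<in> vcarrier (dual_space V)" for f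
    using dual_expand[OF assms that] that by simp
  then show ?thesis
    using dual_basisD(1-3)[OF assms(2)] assms(1)
    unfolding dual_basis_def by (auto simp del: vscale_dual_space)
qed

section \<open>Tensor products\<close>

lemma vector_space_tensor_scale: "vector_space (tensor_scale :: 'k::field \<Rightarrow> _)"
  by unfold_locales (auto simp: tensor_scale_def fun_eq_iff algebra_simps)

lemma vscale_tensor_space [simp]: "vscale (tensor_space V W) = tensor_scale"
  by (simp add: tensor_space_def)

lemma tensor_scale_apply [simp]: "tensor_scale c p f g = c * p f g"
  by (simp add: tensor_scale_def)

lemma pure_tensor_apply [simp]:
  "\<lbrakk>f \<in> vcarrier (dual_space V); g \<in> vcarrier (dual_space W)\<rbrakk> \<Longrightarrow> pure_tensor V W v w f g = f v * g w"
  by (simp add: pure_tensor_def)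

lemma pure_tensor_expand:
  assumes "fin_dim_vspace V" "fin_dim_vspace W" "dual_basis V B x e" "dual_basis W C y d"
    and "v \<in> vcarrier V" "w \<in> vcarrier W"
  shows "pure_tensor V W v w =
    (\<Sum>b\<in>B. \<Sum>c\<in>C. tensor_scale (e b v * d c w) (pure_tensor V W (x b) (y c)))"
proof (intro ext)
  fix f g
  show "pure_tensor V W v w f g =
    (\<Sum>b\<in>B. \<Sum>c\<in>C. tensor_scale (e b v * d c w) (pure_tensor V W (x b) (y c))) f g"
  proof (cases "f \<in> vcarrier (dual_space V) \<and> g \<in> vcarrier (dual_space W)")
    case True
    then have f: "f \<in> vcarrier (dual_space V)" and g: "g \<in> vcarrier (dual_space W)" by auto
    have "f v * g w = (\<Sum>b\<in>B. e b v * f (x b)) * (\<Sum>c\<in>C. d c w * g (y c))"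
      using dual_basis_apply[OF assms(1,3) f assms(5)] dual_basis_apply[OF assms(2,4) g assms(6)]
      by (rule arg_cong2)
    also have "\<dots> = (\<Sum>b\<in>B. \<Sum>c\<in>C. tensor_scale (e b v * d c w) (pure_tensor V W (x b) (y c)) f g)"
      unfolding sum_product using f g by (intro sum.cong refl) simp
    finally show ?thesis using f g by (simp add: sum_fun_apply)
  qed (auto simp: sum_fun_apply pure_tensor_def)
qed

lemma fin_dim_tensor [simp]:
  fixes V :: "('k::field, 'v::ab_group_add) vspace" and W :: "('k, 'w::ab_group_add) vspace"
  assumes "fin_dim_vspace V" "fin_dim_vspace W"
  shows "fin_dim_vspace (tensor_space V W)"
proof -
  interpret vector_space "tensor_scale :: 'k \<Rightarrow> ('k, 'v, 'w) tensor \<Rightarrow> _"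
    by (rule vector_space_tensor_scale)
  obtain B x e C y d where B: "dual_basis V B x e" and C: "dual_basis W C y d"
    using dual_basis_exists assms by meson
  define S where "S = (\<lambda>(b, c). pure_tensor V W (x b) (y c)) ` (B \<times> C)"
  let ?P = "{pure_tensor V W v w | v w. v \<in> vcarrier V \<and> w \<in> vcarrier W}"
  have fin: "finite S" unfolding S_def using dual_basisD(1)[OF B] dual_basisD(1)[OF C] by simp
  have "S \<subseteq> ?P" unfolding S_def using dual_basisD(2)[OF B] dual_basisD(2)[OF C] by fastforce
  then have "span S \<subseteq> span ?P" by (rule span_mono)
  moreover have "?P \<subseteq> span S"
  proof clarify
    fix v w assume "v \<in> vcarrier V" "w \<in> vcarrier W"
    then show "pure_tensor V W v w \<in> span S"
      unfolding pure_tensor_expand[OF assms B C \<open>v \<in> _\<close> \<open>w \<in> _\<close>]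
      by (intro span_sum span_scale span_base) (auto simp: S_def)
  qed
  then have "span ?P \<subseteq> span S"
    by (rule span_minimal) (rule subspace_span)
  ultimately have "vcarrier (tensor_space V W) = span S" by (auto simp: tensor_space_def)
  then show ?thesis using fin vector_space_axioms by (auto simp: fin_dim_vspace_def)
qed

lemma pure_tensor_in [simp]:
  fixes V :: "('k::field, 'v::ab_group_add) vspace" and W :: "('k, 'w::ab_group_add) vspace"
  assumes "v \<in> vcarrier V" "w \<in> vcarrier W"
  shows "pure_tensor V W v w \<in> vcarrier (tensor_space V W)"
proof -
  interpret vector_space "tensor_scale :: 'k \<Rightarrow> ('k, 'v, 'w) tensor \<Rightarrow> _"
    by (rule vector_space_tensor_scale)
  show ?thesis unfolding tensor_space_def using assms by (auto intro: span_base)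
qed

lemma pure_tensor_bilinear [simp]:
  assumes "fin_dim_vspace V" "fin_dim_vspace W"
  shows "bilinear_between V W (tensor_space V W) (pure_tensor V W)"
proof (intro bilinear_betweenI linear_betweenI)
  fix v v' w c assume v: "v \<in> vcarrier V" "v' \<in> vcarrier V" and w: "w \<in> vcarrier W"
  show "pure_tensor V W (v + v') w = pure_tensor V W v w + pure_tensor V W v' w"
    using linear_between_add[OF dual_linear] v
    by (fastforce simp: pure_tensor_def fun_eq_iff algebra_simps)
next
  fix v w w' c assume v: "v \<in> vcarrier V" and w: "w \<in> vcarrier W" "w' \<in> vcarrier W"
  show "pure_tensor V W v (w + w') = pure_tensor V W v w + pure_tensor V W v w'"
    using linear_between_add[OF dual_linear] w
    by (fastforce simp: pure_tensor_def fun_eq_iff algebra_simps)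
next
  fix v w c assume v: "v \<in> vcarrier V" and w: "w \<in> vcarrier W"
  show "pure_tensor V W (vscale V c v) w = vscale (tensor_space V W) c (pure_tensor V W v w)"
    using linear_between_scale[OF dual_linear] v
    by (fastforce simp: pure_tensor_def fun_eq_iff algebra_simps)
  show "pure_tensor V W v (vscale W c w) = vscale (tensor_space V W) c (pure_tensor V W v w)"
    using linear_between_scale[OF dual_linear] w
    by (fastforce simp: pure_tensor_def fun_eq_iff algebra_simps)
qed simp_all

text \<open>The span is built from scaled generators, but a scalar can be moved into the first
  factor of a pure tensor, so adding one pure tensor is the only case besides zero.\<close>

lemma tensor_induct [consumes 3, case_names zero add]:
  fixes V :: "('k::field, 'v::ab_group_add) vspace" and W :: "('k, 'w::ab_group_add) vspace"
  assumes V: "fin_dim_vspace V" "fin_dim_vspace W" and p: "p \<in> vcarrier (tensor_space V W)"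
    and 0: "P 0"
    and add: "\<And>v w p. \<lbrakk>v \<in> vcarrier V; w \<in> vcarrier W; p \<in> vcarrier (tensor_space V W); P p\<rbrakk>
               \<Longrightarrow> P (pure_tensor V W v w + p)"
  shows "P p"
proof -
  interpret vector_space "tensor_scale :: 'k \<Rightarrow> ('k, 'v, 'w) tensor \<Rightarrow> _"
    by (rule vector_space_tensor_scale)
  have "p \<in> span {pure_tensor V W v w | v w. v \<in> vcarrier V \<and> w \<in> vcarrier W}"
    using p by (simp add: tensor_space_def)
  then have "p \<in> vcarrier (tensor_space V W) \<and> P p"
  proof (induction rule: span_induct_alt)
    case base
    show ?case using 0 V by (simp del: zero_fun_apply)
  next
    case (step c q y)
    then obtain v w where vw: "v \<in> vcarrier V" "w \<in> vcarrier W" "q = pure_tensor V W v w" by blast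
    have q: "tensor_scale c q = pure_tensor V W (vscale V c v) w"
      using vw linear_between_scale[OF bilinear_between_left[OF pure_tensor_bilinear[OF V]]]
      by fastforce
    show ?case unfolding q using step vw V
      by (simp add: add del: plus_fun_apply)
  qed
  then show ?thesis ..
qed

text \<open>With this, \<open>tensor_eqI\<close> has to compare tensors at genuine functionals
  only.\<close>

lemma tensor_outside:
  assumes "fin_dim_vspace V" "fin_dim_vspace W" "p \<in> vcarrier (tensor_space V W)"
    and "f \<notin> vcarrier (dual_space V) \<or> g \<notin> vcarrier (dual_space W)"
  shows "p f g = 0"
  using assms by (induction rule: tensor_induct) (auto simp: pure_tensor_def)

lemma bilinear_between_plus:
  assumes "bilinear_between U V ground p" "bilinear_between U V ground q"
  shows "bilinear_between U V ground (p + q)"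
proof (intro bilinear_betweenI linear_betweenI)
  fix u v v' c assume u: "u \<in> vcarrier U" and v: "v \<in> vcarrier V" "v' \<in> vcarrier V"
  note p = bilinear_between_right[OF assms(1) u] and q = bilinear_between_right[OF assms(2) u]
  show "(p + q) u (v + v') = (p + q) u v + (p + q) u v'"
    using linear_between_add[OF p v] linear_between_add[OF q v] by simp
next
  fix u v c assume u: "u \<in> vcarrier U" and v: "v \<in> vcarrier V"
  note p = bilinear_between_right[OF assms(1) u] and q = bilinear_between_right[OF assms(2) u]
  show "(p + q) u (vscale V c v) = vscale ground c ((p + q) u v)"
    using linear_between_scale[OF p v] linear_between_scale[OF q v] by (simp add: algebra_simps)
next
  fix u u' v assume u: "u \<in> vcarrier U" "u' \<in> vcarrier U" and v: "v \<in> vcarrier V"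
  note p = bilinear_between_left[OF assms(1) v] and q = bilinear_between_left[OF assms(2) v]
  show "(p + q) (u + u') v = (p + q) u v + (p + q) u' v"
    using linear_between_add[OF p u] linear_between_add[OF q u] by simp
next
  fix u v c assume u: "u \<in> vcarrier U" and v: "v \<in> vcarrier V"
  note p = bilinear_between_left[OF assms(1) v] and q = bilinear_between_left[OF assms(2) v]
  show "(p + q) (vscale U c u) v = vscale ground c ((p + q) u v)"
    using linear_between_scale[OF p u] linear_between_scale[OF q u] by (simp add: algebra_simps)
qed simp_all

lemma tensor_bilinear:
  assumes "fin_dim_vspace V" "fin_dim_vspace W" "p \<in> vcarrier (tensor_space V W)"
  shows "bilinear_between (dual_space V) (dual_space W) ground p"
proof -
  have V: "f + f' \<in> vcarrier (dual_space V)" "(\<lambda>v. c * f v) \<in> vcarrier (dual_space V)"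
    if "f \<in> vcarrier (dual_space V)" "f' \<in> vcarrier (dual_space V)" for f f' c
    using that assms(1) fin_dim_add[of "dual_space V"] fin_dim_scale[of "dual_space V" f c] by auto
  have W: "g + g' \<in> vcarrier (dual_space W)" "(\<lambda>v. c * g v) \<in> vcarrier (dual_space W)"
    if "g \<in> vcarrier (dual_space W)" "g' \<in> vcarrier (dual_space W)" for g g' c
    using that assms(2) fin_dim_add[of "dual_space W"] fin_dim_scale[of "dual_space W" g c] by auto
  show ?thesis
    using assms
  proof (induction rule: tensor_induct)
    case (add v w p)
    have "bilinear_between (dual_space V) (dual_space W) ground (pure_tensor V W v w)"
      by (intro bilinear_betweenI linear_betweenI) (simp_all add: V W algebra_simps)
    then show ?case using add.IH by (rule bilinear_between_plus)
  qed (simp add: bilinear_between_def linear_between_def)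
qed

lemma tensor_eqI:
  assumes "fin_dim_vspace V" "fin_dim_vspace W"
    and "p \<in> vcarrier (tensor_space V W)" "q \<in> vcarrier (tensor_space V W)"
    and "\<And>f g. \<lbrakk>f \<in> vcarrier (dual_space V); g \<in> vcarrier (dual_space W)\<rbrakk> \<Longrightarrow> p f g = q f g"
  shows "p = q"
proof (intro ext)
  fix f g show "p f g = q f g"
    using assms(5) tensor_outside[OF assms(1,2,3)] tensor_outside[OF assms(1,2,4)]
    by (cases "f \<in> vcarrier (dual_space V) \<and> g \<in> vcarrier (dual_space W)") auto
qed

text \<open>The numbers \<open>p (e b) (d c)\<close> are coordinates of \<open>p\<close> in the pure
  tensors of basis vectors.\<close>

lemma tensor_apply_expand:
  assumes "fin_dim_vspace V" "fin_dim_vspace W" "dual_basis V B x e" "dual_basis W C y d"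
    and "p \<in> vcarrier (tensor_space V W)"
    and "f \<in> vcarrier (dual_space V)" "g \<in> vcarrier (dual_space W)"
  shows "p f g = (\<Sum>b\<in>B. \<Sum>c\<in>C. p (e b) (d c) * (f (x b) * g (y c)))"
  using assms(1,2,5)
proof (induction rule: tensor_induct)
  case (add v w p)
  have "pure_tensor V W v w f g = (\<Sum>b\<in>B. e b v * f (x b)) * (\<Sum>c\<in>C. d c w * g (y c))"
    using dual_basis_apply[OF assms(1,3,6) add(1)] dual_basis_apply[OF assms(2,4,7) add(2)] assms(6,7)
    by simp
  also have "\<dots> = (\<Sum>b\<in>B. \<Sum>c\<in>C. pure_tensor V W v w (e b) (d c) * (f (x b) * g (y c)))"
    unfolding sum_product
    by (intro sum.cong refl) (simp add: dual_basisD(3)[OF assms(3)] dual_basisD(3)[OF assms(4)])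
  finally show ?case using add by (simp add: algebra_simps sum.distrib)
qed simp

section \<open>The universal property of the tensor product\<close>

lemma tensor_repr_exists:
  assumes "fin_dim_vspace V" "fin_dim_vspace W" "p \<in> vcarrier (tensor_space V W)"
  shows "\<exists>ps. tensor_repr V W p ps"
  using assms
proof (induction rule: tensor_induct)
  case zero
  have "tensor_repr V W 0 []" by (simp add: tensor_repr_def)
  then show ?case ..
next
  case (add v w p)
  then obtain ps where "tensor_repr V W p ps" by blast
  then have "tensor_repr V W (pure_tensor V W v w + p) ((v, w) # ps)"
    using add by (simp add: tensor_repr_def)
  then show ?case ..
qed

lemma bilinear_expand:
  assumes "fin_dim_vspace V" "fin_dim_vspace W" "fin_dim_vspace U"
    and "dual_basis V B x e" "dual_basis W C y d" "bilinear_between V W U \<beta>"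
    and v: "v \<in> vcarrier V" and w: "w \<in> vcarrier W"
  shows "\<beta> v w = (\<Sum>b\<in>B. \<Sum>c\<in>C. vscale U (e b v * d c w) (\<beta> (x b) (y c)))"
proof -
  have "\<beta> v w = \<beta> (\<Sum>b\<in>B. vscale V (e b v) (x b)) w"
    by (simp only: dual_basisD(4)[OF assms(4) v])
  also have "\<dots> = (\<Sum>b\<in>B. vscale U (e b v) (\<beta> (x b) w))"
    by (rule linear_between_lincomb[OF assms(1) bilinear_between_left[OF assms(6) w] dual_basisD(2)[OF assms(4)]])
  also have "\<dots> = (\<Sum>b\<in>B. vscale U (e b v) (\<beta> (x b) (\<Sum>c\<in>C. vscale W (d c w) (y c))))"
    by (simp only: dual_basisD(4)[OF assms(5) w])
  also have "\<dots> = (\<Sum>b\<in>B. \<Sum>c\<in>C. vscale U (e b v * d c w) (\<beta> (x b) (y c)))"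
  proof (intro sum.cong refl)
    fix b assume b: "b \<in> B"
    have "\<beta> (x b) (\<Sum>c\<in>C. vscale W (d c w) (y c)) = (\<Sum>c\<in>C. vscale U (d c w) (\<beta> (x b) (y c)))"
      by (rule linear_between_lincomb[OF assms(2) bilinear_between_right[OF assms(6) dual_basisD(2)[OF assms(4) b]]
            dual_basisD(2)[OF assms(5)]])
    then show "vscale U (e b v) (\<beta> (x b) (\<Sum>c\<in>C. vscale W (d c w) (y c))) =
        (\<Sum>c\<in>C. vscale U (e b v * d c w) (\<beta> (x b) (y c)))"
      by (simp add: vscale_simps[OF assms(3)])
  qed
  finally show ?thesis .
qed

text \<open>Well-definedness of Sweedler notation: the right-hand side reads off \<open>p\<close> by
  evaluation and mentions no list of pure tensors any more. Linearity of the lift in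
  \<open>p\<close> is then visible.\<close>

lemma tensor_lift_expand:
  assumes "fin_dim_vspace V" "fin_dim_vspace W" "fin_dim_vspace U"
    and B: "dual_basis V B x e" and C: "dual_basis W C y d" and "bilinear_between V W U \<beta>"
    and p: "p \<in> vcarrier (tensor_space V W)"
  shows "tensor_lift V W \<beta> p = (\<Sum>b\<in>B. \<Sum>c\<in>C. vscale U (p (e b) (d c)) (\<beta> (x b) (y c)))"
proof -
  \<comment> \<open>Claimed for every list of carrier vectors, hence in particular for the one that
    \<open>SOME\<close> picks.\<close>
  have *: "(\<Sum>(v, w)\<leftarrow>ps. \<beta> v w) =
     (\<Sum>b\<in>B. \<Sum>c\<in>C. vscale U ((\<Sum>(v, w)\<leftarrow>ps. pure_tensor V W v w) (e b) (d c)) (\<beta> (x b) (y c)))"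
    if "set ps \<subseteq> vcarrier V \<times> vcarrier W" for ps
    using that
  proof (induction ps)
    case Nil
    show ?case by (simp add: vscale_simps[OF assms(3)])
  next
    case (Cons vw ps)
    obtain v w where vw: "vw = (v, w)" by force
    have "\<beta> v w = (\<Sum>b\<in>B. \<Sum>c\<in>C. vscale U (e b v * d c w) (\<beta> (x b) (y c)))"
      using Cons.prems vw by (intro bilinear_expand[OF assms(1-6)]) auto
    also have "\<dots> = (\<Sum>b\<in>B. \<Sum>c\<in>C. vscale U (pure_tensor V W v w (e b) (d c)) (\<beta> (x b) (y c)))"
      by (intro sum.cong refl arg_cong2[where f = "vscale U"])
         (simp add: dual_basisD(3)[OF B] dual_basisD(3)[OF C])
    finally show ?case using Cons
      by (simp add: vw vscale_simps[OF assms(3)] sum.distrib)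
  qed
  define ps where "ps = (SOME ps. tensor_repr V W p ps)"
  have "tensor_repr V W p ps"
    unfolding ps_def using tensor_repr_exists[OF assms(1,2) p] by (rule someI_ex)
  then show ?thesis using *[of ps] by (simp add: tensor_lift_def ps_def tensor_repr_def)
qed

lemma tensor_lift_linear:
  assumes "fin_dim_vspace V" "fin_dim_vspace W" "fin_dim_vspace U" "bilinear_between V W U \<beta>"
  shows "linear_between (tensor_space V W) U (tensor_lift V W \<beta>)"
proof -
  obtain B x e C y d where B: "dual_basis V B x e" and C: "dual_basis W C y d"
    using dual_basis_exists assms(1,2) by meson
  note eq = tensor_lift_expand[OF assms(1-3) B C assms(4)]
  have in_U: "\<And>b c. b \<in> B \<Longrightarrow> c \<in> C \<Longrightarrow> \<beta> (x b) (y c) \<in> vcarrier U"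
    using bilinear_between_in[OF assms(4) dual_basisD(2)[OF B] dual_basisD(2)[OF C]] .
  show ?thesis
  proof (intro linear_betweenI)
    fix p assume p: "p \<in> vcarrier (tensor_space V W)"
    show "tensor_lift V W \<beta> p \<in> vcarrier U"
      unfolding eq[OF p] using assms(3) in_U by (intro fin_dim_sum fin_dim_scale)
  next
    fix p q assume pq: "p \<in> vcarrier (tensor_space V W)" "q \<in> vcarrier (tensor_space V W)"
    have "p + q \<in> vcarrier (tensor_space V W)" using assms pq by (intro fin_dim_add fin_dim_tensor)
    then show "tensor_lift V W \<beta> (p + q) = tensor_lift V W \<beta> p + tensor_lift V W \<beta> q"
      using pq by (simp only: eq plus_fun_apply vscale_simps[OF assms(3)] sum.distrib)
  next
    fix p c assume p: "p \<in> vcarrier (tensor_space V W)"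
    then have "tensor_scale c p \<in> vcarrier (tensor_space V W)"
      using fin_dim_scale[of "tensor_space V W" p c] assms by simp
    then show "tensor_lift V W \<beta> (vscale (tensor_space V W) c p) = vscale U c (tensor_lift V W \<beta> p)"
      using p by (simp only: eq vscale_tensor_space tensor_scale_apply vscale_simps[OF assms(3)])
  qed
qed

text \<open>A linear map passes through the finite sum. The typical \<open>h\<close> is a
  functional, or evaluation at a pair of functionals, so that a test is pushed inside a
  lift.\<close>

lemma tensor_lift_apply:
  assumes "fin_dim_vspace V" "fin_dim_vspace W" "fin_dim_vspace U" "fin_dim_vspace X"
    and "bilinear_between V W U \<beta>" "linear_between U X h" "p \<in> vcarrier (tensor_space V W)"
  shows "h (tensor_lift V W \<beta> p) = tensor_lift V W (\<lambda>v w. h (\<beta> v w)) p"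
proof -
  obtain B x e C y d where B: "dual_basis V B x e" and C: "dual_basis W C y d"
    using dual_basis_exists assms(1,2) by meson
  have in_U: "\<And>b c. b \<in> B \<Longrightarrow> c \<in> C \<Longrightarrow> \<beta> (x b) (y c) \<in> vcarrier U"
    using bilinear_between_in[OF assms(5) dual_basisD(2)[OF B] dual_basisD(2)[OF C]] .
  have "h (tensor_lift V W \<beta> p) = h (\<Sum>b\<in>B. \<Sum>c\<in>C. vscale U (p (e b) (d c)) (\<beta> (x b) (y c)))"
    using tensor_lift_expand[OF assms(1-3) B C assms(5,7)] by simp
  also have "\<dots> = (\<Sum>b\<in>B. h (\<Sum>c\<in>C. vscale U (p (e b) (d c)) (\<beta> (x b) (y c))))"
    using in_U assms(3) by (intro linear_between_sum[OF assms(3,6)] fin_dim_sum) auto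
  also have "\<dots> = (\<Sum>b\<in>B. \<Sum>c\<in>C. vscale X (p (e b) (d c)) (h (\<beta> (x b) (y c))))"
    using in_U assms(3) by (intro sum.cong refl linear_between_lincomb[OF assms(3,6)]) auto
  finally show ?thesis
    using tensor_lift_expand[OF assms(1,2,4) B C bilinear_between_compose[OF assms(5,6)] assms(7)]
    by simp
qed

text \<open>The chosen list depends on \<open>p\<close> only, so both sums run over the same list,
  and its entries lie in the carriers.\<close>

lemma tensor_lift_cong:
  assumes "fin_dim_vspace V" "fin_dim_vspace W" "p \<in> vcarrier (tensor_space V W)"
    and "\<And>v w. \<lbrakk>v \<in> vcarrier V; w \<in> vcarrier W\<rbrakk> \<Longrightarrow> \<beta> v w = \<gamma> v w"
  shows "tensor_lift V W \<beta> p = tensor_lift V W \<gamma> p"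
proof -
  define ps where "ps = (SOME ps. tensor_repr V W p ps)"
  have "tensor_repr V W p ps"
    unfolding ps_def using tensor_repr_exists[OF assms(1-3)] by (rule someI_ex)
  then have "map (\<lambda>(v, w). \<beta> v w) ps = map (\<lambda>(v, w). \<gamma> v w) ps"
    using assms(4) by (intro map_cong refl) (auto simp: tensor_repr_def)
  then show ?thesis unfolding tensor_lift_def ps_def[symmetric] by (rule arg_cong)
qed

lemma functional_mult_bilinear:
  assumes "linear_between V ground f" "linear_between W ground g"
  shows "bilinear_between V W ground (\<lambda>v w. f v * g w)"
  using assms by (auto simp: bilinear_between_def linear_between_def algebra_simps)

text \<open>The link between Sweedler sums and evaluation of forms. The maps \<open>f\<close> and
  \<open>g\<close> may be nonzero off the carriers, so \<open>p\<close> receives their cut-off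
  versions.\<close>

lemma tensor_lift_functionals:
  assumes "fin_dim_vspace V" "fin_dim_vspace W" "p \<in> vcarrier (tensor_space V W)"
    and "linear_between V ground f" "linear_between W ground g"
  shows "tensor_lift V W (\<lambda>v w. f v * g w) p = p (restrict0 V f) (restrict0 W g)"
proof -
  obtain B x e C y d where B: "dual_basis V B x e" and C: "dual_basis W C y d"
    using dual_basis_exists assms(1,2) by meson
  have "tensor_lift V W (\<lambda>v w. f v * g w) p = (\<Sum>b\<in>B. \<Sum>c\<in>C. p (e b) (d c) * (f (x b) * g (y c)))"
    using tensor_lift_expand[OF assms(1,2) fin_dim_ground B C functional_mult_bilinear[OF assms(4,5)] assms(3)]
    by simp
  also have "\<dots> = (\<Sum>b\<in>B. \<Sum>c\<in>C. p (e b) (d c) * (restrict0 V f (x b) * restrict0 W g (y c)))"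
    by (intro sum.cong refl) (simp add: dual_basisD(2)[OF B] dual_basisD(2)[OF C])
  also have "\<dots> = p (restrict0 V f) (restrict0 W g)"
    by (rule tensor_apply_expand[OF assms(1,2) B C assms(3) restrict0_in_dual[OF assms(1,4)]
          restrict0_in_dual[OF assms(2,5)], symmetric])
  finally show ?thesis .
qed

lemma tensor_lift_dual:
  assumes "fin_dim_vspace V" "fin_dim_vspace W" "p \<in> vcarrier (tensor_space V W)"
    and "f \<in> vcarrier (dual_space V)" "g \<in> vcarrier (dual_space W)"
  shows "tensor_lift V W (\<lambda>v w. f v * g w) p = p f g"
  using tensor_lift_functionals[OF assms(1-3) dual_linear[OF assms(4)] dual_linear[OF assms(5)]]
  by (simp add: restrict0_dual assms)

lemma tensor_lift_pure:
  assumes "fin_dim_vspace V" "fin_dim_vspace W" "fin_dim_vspace U" "bilinear_between V W U \<beta>"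
    and "v \<in> vcarrier V" "w \<in> vcarrier W"
  shows "tensor_lift V W \<beta> (pure_tensor V W v w) = \<beta> v w"
proof -
  obtain B x e C y d where B: "dual_basis V B x e" and C: "dual_basis W C y d"
    using dual_basis_exists assms(1,2) by meson
  have "tensor_lift V W \<beta> (pure_tensor V W v w) =
      (\<Sum>b\<in>B. \<Sum>c\<in>C. vscale U (pure_tensor V W v w (e b) (d c)) (\<beta> (x b) (y c)))"
    by (intro tensor_lift_expand B C assms pure_tensor_in)
  also have "\<dots> = (\<Sum>b\<in>B. \<Sum>c\<in>C. vscale U (e b v * d c w) (\<beta> (x b) (y c)))"
    by (intro sum.cong refl) (simp add: dual_basisD(3)[OF B] dual_basisD(3)[OF C])
  finally show ?thesis using bilinear_expand[OF assms(1-3) B C assms(4-6)] by simp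
qed

lemma bilinear_between_cong:
  assumes "bilinear_between U V W \<beta>" "fin_dim_vspace U" "fin_dim_vspace V"
    and "\<And>u v. \<lbrakk>u \<in> vcarrier U; v \<in> vcarrier V\<rbrakk> \<Longrightarrow> \<gamma> u v = \<beta> u v"
  shows "bilinear_between U V W \<gamma>"
  using assms by (auto simp: bilinear_between_def intro: linear_between_cong)

lemma bilinear_between_precompose:
  assumes "bilinear_between U V W \<beta>" "linear_between U' U S" "linear_between V' V T"
  shows "bilinear_between U' V' W (\<lambda>u v. \<beta> (S u) (T v))"
  using assms by (simp add: bilinear_between_def linear_between_def)

text \<open>Supplies the bilinearity of the outer map when lifts are nested, as in
  \<open>tensor_assoc\<close> and \<open>tensor_mult\<close>: the inner lift is taken at a fixed
  tensor and varies with an outer variable.\<close>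

lemma tensor_lift_param_linear:
  assumes "fin_dim_vspace V" "fin_dim_vspace W" "fin_dim_vspace U" "fin_dim_vspace X"
    and "p \<in> vcarrier (tensor_space V W)"
    and \<beta>: "\<And>x. x \<in> vcarrier X \<Longrightarrow> bilinear_between V W U (\<beta> x)"
    and lin: "\<And>v w. \<lbrakk>v \<in> vcarrier V; w \<in> vcarrier W\<rbrakk> \<Longrightarrow> linear_between X U (\<lambda>x. \<beta> x v w)"
  shows "linear_between X U (\<lambda>x. tensor_lift V W (\<beta> x) p)"
proof -
  obtain B a e C b d where B: "dual_basis V B a e" and C: "dual_basis W C b d"
    using dual_basis_exists assms(1,2) by meson
  note eq = tensor_lift_expand[OF assms(1-3) B C \<beta> assms(5)]
  show ?thesis
  proof (rule linear_betweenI)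
    fix x assume "x \<in> vcarrier X"
    then show "tensor_lift V W (\<beta> x) p \<in> vcarrier U"
      using linear_between_in[OF tensor_lift_linear[OF assms(1-3) \<beta>] assms(5)] by simp
  next
    fix x x' assume x: "x \<in> vcarrier X" "x' \<in> vcarrier X"
    then have "x + x' \<in> vcarrier X" using assms(4) by simp
    then show "tensor_lift V W (\<beta> (x + x')) p = tensor_lift V W (\<beta> x) p + tensor_lift V W (\<beta> x') p"
      unfolding eq[OF x(1)] eq[OF x(2)] eq[OF \<open>x + x' \<in> _\<close>] sum.distrib[symmetric]
      using x linear_between_add[OF lin[OF dual_basisD(2)[OF B] dual_basisD(2)[OF C]]]
      by (intro sum.cong refl) (simp add: vscale_simps[OF assms(3)])
  next
    fix x c assume x: "x \<in> vcarrier X"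
    then have cx: "vscale X c x \<in> vcarrier X" using assms(4) by simp
    then show "tensor_lift V W (\<beta> (vscale X c x)) p = vscale U c (tensor_lift V W (\<beta> x) p)"
      unfolding eq[OF x(1)] eq[OF cx] vscale_simps(7)[OF assms(3)]
      using x linear_between_scale[OF lin[OF dual_basisD(2)[OF B] dual_basisD(2)[OF C]]]
      by (intro sum.cong refl) (simp add: vscale_simps[OF assms(3)] mult.commute)
  qed
qed

lemma tensor_eval_linear:
  "linear_between (tensor_space V W) ground (\<lambda>p. p f g)"
  by (rule linear_betweenI) auto

section \<open>Tensor products of linear maps\<close>

lemma tensor_map_bilinear:
  assumes "fin_dim_vspace V'" "fin_dim_vspace W'" "linear_between V V' S" "linear_between W W' T"
  shows "bilinear_between V W (tensor_space V' W') (\<lambda>v w. pure_tensor V' W' (S v) (T w))"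
  using assms by (intro bilinear_between_precompose[OF pure_tensor_bilinear])

lemma tensor_map_in:
  assumes "fin_dim_vspace V" "fin_dim_vspace W" "fin_dim_vspace V'" "fin_dim_vspace W'"
    and "linear_between V V' S" "linear_between W W' T" "p \<in> vcarrier (tensor_space V W)"
  shows "tensor_map V W V' W' S T p \<in> vcarrier (tensor_space V' W')"
  unfolding tensor_map_def
  by (rule linear_between_in[OF tensor_lift_linear[OF assms(1,2) _ tensor_map_bilinear[OF assms(3-6)]] assms(7)])
     (simp add: assms)

text \<open>The transposes of \<open>S\<close> and \<open>T\<close> act on the test functionals.
  This is what turns a map applied to one leg of a comultiplication into an argument of a dual
  product.\<close>

lemma tensor_map_apply:
  assumes "fin_dim_vspace V" "fin_dim_vspace W" "fin_dim_vspace V'" "fin_dim_vspace W'"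
    and "linear_between V V' S" "linear_between W W' T" "p \<in> vcarrier (tensor_space V W)"
    and f: "f \<in> vcarrier (dual_space V')" and g: "g \<in> vcarrier (dual_space W')"
  shows "tensor_map V W V' W' S T p f g = p (restrict0 V (\<lambda>v. f (S v))) (restrict0 W (\<lambda>w. g (T w)))"
proof -
  have "tensor_map V W V' W' S T p f g =
      tensor_lift V W (\<lambda>v w. pure_tensor V' W' (S v) (T w) f g) p"
    unfolding tensor_map_def
    using assms(1-4)
    by (intro tensor_lift_apply[OF _ _ _ _ tensor_map_bilinear[OF assms(3-6)] tensor_eval_linear assms(7)]) auto
  also have "\<dots> = tensor_lift V W (\<lambda>v w. f (S v) * g (T w)) p" using f g by simp
  also have "\<dots> = p (restrict0 V (\<lambda>v. f (S v))) (restrict0 W (\<lambda>w. g (T w)))"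
    by (intro tensor_lift_functionals assms linear_between_compose[OF assms(5) dual_linear[OF f]]
          linear_between_compose[OF assms(6) dual_linear[OF g]])
  finally show ?thesis .
qed

text \<open>The functional f \<otimes> g on V \<otimes> W. A tensor over U and V \<otimes> W takes
  as its second argument a functional on V \<otimes> W, not a pair of functionals, so these need to
  be available as single objects.\<close>

definition tensor_eval where
  "tensor_eval V W f g = restrict0 (tensor_space V W) (\<lambda>p. p f g)"

lemma tensor_eval_apply [simp]: "p \<in> vcarrier (tensor_space V W) \<Longrightarrow> tensor_eval V W f g p = p f g"
  by (simp add: tensor_eval_def)

lemma tensor_eval_in [simp]:
  "\<lbrakk>fin_dim_vspace V; fin_dim_vspace W\<rbrakk> \<Longrightarrow> tensor_eval V W f g \<in> vcarrier (dual_space (tensor_space V W))"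
  unfolding tensor_eval_def by (intro restrict0_in_dual tensor_eval_linear) simp

section \<open>Contraction of one tensor factor with a functional\<close>

lemma scale_left_bilinear:
  assumes "fin_dim_vspace V" "fin_dim_vspace W" "linear_between V ground \<epsilon>"
  shows "bilinear_between V W W (\<lambda>v w. vscale W (\<epsilon> v) w)"
  using assms
  by (intro bilinear_betweenI linear_betweenI)
     (simp_all add: vscale_simps linear_between_add linear_between_scale mult.commute)

lemma scale_right_bilinear:
  assumes "fin_dim_vspace V" "fin_dim_vspace W" "linear_between W ground \<epsilon>"
  shows "bilinear_between V W V (\<lambda>v w. vscale V (\<epsilon> w) v)"
  using assms
  by (intro bilinear_betweenI linear_betweenI)
     (simp_all add: vscale_simps linear_between_add linear_between_scale mult.commute)

text \<open>This is \<epsilon> \<otimes> id followed by the identification of k \<otimes> W with W;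
  a functional on the result fills the remaining slot of \<open>p\<close>. It serves the counit laws
  and also the removal of the first factor in triple tensors.\<close>

lemma
  assumes "fin_dim_vspace V" "fin_dim_vspace W" "linear_between V ground \<epsilon>"
    and "p \<in> vcarrier (tensor_space V W)"
  shows contract_left_in: "tensor_lift V W (\<lambda>v w. vscale W (\<epsilon> v) w) p \<in> vcarrier W"
    and contract_left_apply: "g \<in> vcarrier (dual_space W) \<Longrightarrow>
      g (tensor_lift V W (\<lambda>v w. vscale W (\<epsilon> v) w) p) = p (restrict0 V \<epsilon>) g"
proof -
  note bil = scale_left_bilinear[OF assms(1-3)]
  show "tensor_lift V W (\<lambda>v w. vscale W (\<epsilon> v) w) p \<in> vcarrier W"
    by (rule linear_between_in[OF tensor_lift_linear[OF assms(1,2,2) bil] assms(4)])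
  assume g: "g \<in> vcarrier (dual_space W)"
  have "g (tensor_lift V W (\<lambda>v w. vscale W (\<epsilon> v) w) p) = tensor_lift V W (\<lambda>v w. g (vscale W (\<epsilon> v) w)) p"
    using g by (intro tensor_lift_apply[OF assms(1,2,2) fin_dim_ground bil _ assms(4)] dual_linear)
  also have "\<dots> = tensor_lift V W (\<lambda>v w. \<epsilon> v * g w) p"
    using linear_between_scale[OF dual_linear[OF g]] by (intro tensor_lift_cong assms) simp
  also have "\<dots> = p (restrict0 V \<epsilon>) g"
    using tensor_lift_functionals[OF assms(1,2,4,3) dual_linear[OF g]] g by (simp add: restrict0_dual)
  finally show "g (tensor_lift V W (\<lambda>v w. vscale W (\<epsilon> v) w) p) = p (restrict0 V \<epsilon>) g" .
qed

lemma
  assumes "fin_dim_vspace V" "fin_dim_vspace W" "linear_between W ground \<epsilon>"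
    and "p \<in> vcarrier (tensor_space V W)"
  shows contract_right_in: "tensor_lift V W (\<lambda>v w. vscale V (\<epsilon> w) v) p \<in> vcarrier V"
    and contract_right_apply: "f \<in> vcarrier (dual_space V) \<Longrightarrow>
      f (tensor_lift V W (\<lambda>v w. vscale V (\<epsilon> w) v) p) = p f (restrict0 W \<epsilon>)"
proof -
  note bil = scale_right_bilinear[OF assms(1-3)]
  show "tensor_lift V W (\<lambda>v w. vscale V (\<epsilon> w) v) p \<in> vcarrier V"
    by (rule linear_between_in[OF tensor_lift_linear[OF assms(1,2,1) bil] assms(4)])
  assume f: "f \<in> vcarrier (dual_space V)"
  have "f (tensor_lift V W (\<lambda>v w. vscale V (\<epsilon> w) v) p) = tensor_lift V W (\<lambda>v w. f (vscale V (\<epsilon> w) v)) p"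
    using f by (intro tensor_lift_apply[OF assms(1,2,1) fin_dim_ground bil _ assms(4)] dual_linear)
  also have "\<dots> = tensor_lift V W (\<lambda>v w. f v * \<epsilon> w) p"
    using linear_between_scale[OF dual_linear[OF f]] by (intro tensor_lift_cong assms) simp
  also have "\<dots> = p f (restrict0 W \<epsilon>)"
    using tensor_lift_functionals[OF assms(1,2,4) dual_linear[OF f] assms(3)] f by (simp add: restrict0_dual)
  finally show "f (tensor_lift V W (\<lambda>v w. vscale V (\<epsilon> w) v) p) = p f (restrict0 W \<epsilon>)" .
qed

text \<open>Contracting the first factor with \<open>f\<close> reduces the claim to \<open>tensor_eqI\<close> in \<open>V \<otimes> W\<close>.\<close>

lemma tensor3_eqI:
  assumes "fin_dim_vspace U" "fin_dim_vspace V" "fin_dim_vspace W"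
    and p: "p \<in> vcarrier (tensor_space U (tensor_space V W))"
    and q: "q \<in> vcarrier (tensor_space U (tensor_space V W))"
    and eq: "\<And>f g h. \<lbrakk>f \<in> vcarrier (dual_space U); g \<in> vcarrier (dual_space V); h \<in> vcarrier (dual_space W)\<rbrakk>
       \<Longrightarrow> p f (tensor_eval V W g h) = q f (tensor_eval V W g h)"
  shows "p = q"
proof (rule tensor_eqI[OF assms(1) _ p q])
  fix f \<omega> assume f: "f \<in> vcarrier (dual_space U)" and \<omega>: "\<omega> \<in> vcarrier (dual_space (tensor_space V W))"
  have VW: "fin_dim_vspace (tensor_space V W)" using assms by simp
  define s where "s = tensor_lift U (tensor_space V W) (\<lambda>u r. vscale (tensor_space V W) (f u) r)"
  note s_in = contract_left_in[OF assms(1) VW dual_linear[OF f], folded s_def]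
  have s_apply: "\<omega>' (s r) = r f \<omega>'"
    if "r \<in> vcarrier (tensor_space U (tensor_space V W))" "\<omega>' \<in> vcarrier (dual_space (tensor_space V W))"
    for r \<omega>'
    using contract_left_apply[OF assms(1) VW dual_linear[OF f] that] f
    by (simp add: s_def restrict0_dual)
  have "s p = s q"
  proof (rule tensor_eqI[OF assms(2,3) s_in[OF p] s_in[OF q]])
    fix g h assume "g \<in> vcarrier (dual_space V)" "h \<in> vcarrier (dual_space W)"
    then have "tensor_eval V W g h (s p) = tensor_eval V W g h (s q)"
      using eq[OF f] assms(2,3) by (simp only: s_apply p q tensor_eval_in)
    then show "s p g h = s q g h" using s_in[OF p] s_in[OF q] by simp
  qed
  then show "p f \<omega> = q f \<omega>" using s_apply[OF p \<omega>] s_apply[OF q \<omega>] by simp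
qed (use assms in simp)

text \<open>By \<open>tensor3_eqI\<close> the values on product functionals determine the
  rebracketed tensor, so no formula for other functionals on V \<otimes> W is required.\<close>

lemma
  assumes "fin_dim_vspace U" "fin_dim_vspace V" "fin_dim_vspace W"
    and q: "q \<in> vcarrier (tensor_space (tensor_space U V) W)"
  shows tensor_assoc_in: "tensor_assoc U V W q \<in> vcarrier (tensor_space U (tensor_space V W))"
    and tensor_assoc_apply:
      "\<lbrakk>f \<in> vcarrier (dual_space U); g \<in> vcarrier (dual_space V); h \<in> vcarrier (dual_space W)\<rbrakk>
       \<Longrightarrow> tensor_assoc U V W q f (tensor_eval V W g h) = q (tensor_eval U V f g) h"
proof -
  let ?UV = "tensor_space U V" and ?T = "tensor_space U (tensor_space V W)"
  have UV: "fin_dim_vspace ?UV" and VW: "fin_dim_vspace (tensor_space V W)" and T: "fin_dim_vspace ?T"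
    using assms by simp_all
  \<comment> \<open>The parameter \<open>w\<close> comes first, so that \<open>\<beta> w\<close> is
    the bilinear map that the inner lift extends to U \<otimes> V.\<close>
  define \<beta> where "\<beta> = (\<lambda>w u v. pure_tensor U (tensor_space V W) u (pure_tensor V W v w))"
  note P = pure_tensor_bilinear[OF assms(1) VW] and Q = pure_tensor_bilinear[OF assms(2,3)]
  have \<beta>: "bilinear_between U V ?T (\<beta> w)" if "w \<in> vcarrier W" for w
    unfolding \<beta>_def
    using bilinear_between_precompose[OF P linear_between_id(2) bilinear_between_left[OF Q that]] .
  have \<beta>w: "linear_between W ?T (\<lambda>w. \<beta> w u v)" if "u \<in> vcarrier U" "v \<in> vcarrier V" for u v
    unfolding \<beta>_def
    using linear_between_compose[OF bilinear_between_right[OF Q that(2)] bilinear_between_right[OF P that(1)]] .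
  have bil: "bilinear_between ?UV W ?T (\<lambda>p w. tensor_lift U V (\<beta> w) p)"
    by (intro bilinear_betweenI tensor_lift_linear tensor_lift_param_linear \<beta> \<beta>w assms(1-3) T)
  show "tensor_assoc U V W q \<in> vcarrier ?T"
    unfolding tensor_assoc_def
    using linear_between_in[OF tensor_lift_linear[OF UV assms(3) T bil] q] by (simp add: \<beta>_def)
  assume f: "f \<in> vcarrier (dual_space U)" and g: "g \<in> vcarrier (dual_space V)"
    and h: "h \<in> vcarrier (dual_space W)"
  \<comment> \<open>For fixed \<open>w\<close> the scalar \<open>h w\<close> comes out of the inner
    lift and leaves the pairing of \<open>p\<close> with f \<otimes> g.\<close>
  have inner: "tensor_lift U V (\<beta> w) p f (tensor_eval V W g h) = tensor_eval U V f g p * h w"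
    if "p \<in> vcarrier ?UV" "w \<in> vcarrier W" for p w
  proof -
    have "tensor_lift U V (\<beta> w) p f (tensor_eval V W g h) =
        tensor_lift U V (\<lambda>u v. \<beta> w u v f (tensor_eval V W g h)) p"
      by (rule tensor_lift_apply[OF assms(1,2) T fin_dim_ground \<beta>[OF that(2)] tensor_eval_linear that(1)])
    also have "\<dots> = tensor_lift U V (\<lambda>u v. f u * (g v * h w)) p"
      using that assms f g h by (intro tensor_lift_cong) (simp_all add: \<beta>_def)
    also have "\<dots> = tensor_lift U V (\<lambda>u v. h w * (f u * g v)) p" by (simp add: ac_simps)
    also have "\<dots> = h w * tensor_lift U V (\<lambda>u v. f u * g v) p"
      by (rule tensor_lift_apply[OF assms(1,2) fin_dim_ground fin_dim_ground
            functional_mult_bilinear[OF dual_linear[OF f] dual_linear[OF g]] _ that(1), symmetric])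
         (auto simp: linear_between_def algebra_simps)
    finally show ?thesis using tensor_lift_dual[OF assms(1,2) that(1) f g] that by (simp add: mult.commute)
  qed
  have "tensor_assoc U V W q f (tensor_eval V W g h) =
      tensor_lift ?UV W (\<lambda>p w. tensor_lift U V (\<beta> w) p f (tensor_eval V W g h)) q"
    unfolding tensor_assoc_def
    using tensor_lift_apply[OF UV assms(3) T fin_dim_ground bil tensor_eval_linear q] by (simp add: \<beta>_def)
  also have "\<dots> = tensor_lift ?UV W (\<lambda>p w. tensor_eval U V f g p * h w) q"
    by (intro tensor_lift_cong UV assms(3) q inner)
  also have "\<dots> = q (tensor_eval U V f g) h"
    using assms h by (intro tensor_lift_dual UV q) auto
  finally show "tensor_assoc U V W q f (tensor_eval V W g h) = q (tensor_eval U V f g) h" .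
qed

section \<open>Dual multiplications and comultiplications\<close>

lemma tensor_pairing_pure_left:
  assumes "fin_dim_vspace V" "fin_dim_vspace W" "p \<in> vcarrier (tensor_space V W)"
    and "f \<in> vcarrier (dual_space V)" "g \<in> vcarrier (dual_space W)"
  shows "tensor_pairing V W (pure_tensor (dual_space V) (dual_space W) f g) p = p f g"
proof -
  have "bilinear_between (dual_space V) (dual_space W) ground (\<lambda>f g. tensor_lift V W (\<lambda>v w. f v * g w) p)"
    by (rule bilinear_between_cong[OF tensor_bilinear[OF assms(1-3)]])
       (simp_all add: assms(1,2) tensor_lift_dual[OF assms(1-3)])
  then show ?thesis
    unfolding tensor_pairing_def using assms
    by (simp add: tensor_lift_pure[OF fin_dim_dual fin_dim_dual fin_dim_ground] tensor_lift_dual)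
qed

text \<open>A tensor over the dual spaces is a form on the biduals, so a vector enters it as the
  evaluation \<open>dual_eval V v\<close>.\<close>

lemma tensor_pairing_pure_right:
  assumes "fin_dim_vspace V" "fin_dim_vspace W"
    and "\<phi> \<in> vcarrier (tensor_space (dual_space V) (dual_space W))"
    and "v \<in> vcarrier V" "w \<in> vcarrier W"
  shows "tensor_pairing V W \<phi> (pure_tensor V W v w) = \<phi> (dual_eval V v) (dual_eval W w)"
proof -
  have lin: "linear_between (dual_space V) ground (\<lambda>f. f v)" "linear_between (dual_space W) ground (\<lambda>g. g w)"
    by (auto intro: linear_betweenI)
  have "tensor_pairing V W \<phi> (pure_tensor V W v w) =
      tensor_lift (dual_space V) (dual_space W) (\<lambda>f g. f v * g w) \<phi>"
    unfolding tensor_pairing_def using assms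
    by (intro tensor_lift_cong) (simp_all add: tensor_lift_dual)
  also have "\<dots> = \<phi> (dual_eval V v) (dual_eval W w)"
    unfolding dual_eval_def by (intro tensor_lift_functionals lin assms fin_dim_dual)
  finally show ?thesis .
qed

text \<open>Here the encoding of tensors as bilinear forms pays off: the pairing inside
  \<open>dual_mult\<close> is plain evaluation of \<open>\<Delta> u\<close>.\<close>

lemma dual_mult_apply:
  assumes "fin_dim_vspace V" "fin_dim_vspace W" "linear_between U (tensor_space V W) \<Delta>"
    and "f \<in> vcarrier (dual_space V)" "g \<in> vcarrier (dual_space W)" "u \<in> vcarrier U"
  shows "dual_mult U V W \<Delta> f g u = \<Delta> u f g"
  using assms linear_between_in[OF assms(3,6)] by (simp add: dual_mult_def tensor_pairing_pure_left)

lemma dual_mult_eq: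
  assumes "fin_dim_vspace V" "fin_dim_vspace W" "linear_between U (tensor_space V W) \<Delta>"
    and "f \<in> vcarrier (dual_space V)" "g \<in> vcarrier (dual_space W)"
  shows "dual_mult U V W \<Delta> f g = restrict0 U (\<lambda>u. \<Delta> u f g)"
  using dual_mult_apply[OF assms] by (auto simp: restrict0_def dual_mult_def)

lemma dual_mult_in:
  assumes "fin_dim_vspace U" "fin_dim_vspace V" "fin_dim_vspace W" "linear_between U (tensor_space V W) \<Delta>"
    and "f \<in> vcarrier (dual_space V)" "g \<in> vcarrier (dual_space W)"
  shows "dual_mult U V W \<Delta> f g \<in> vcarrier (dual_space U)"
  unfolding dual_mult_eq[OF assms(2-6)]
  using linear_between_add[OF assms(4)] linear_between_scale[OF assms(4)]
  by (intro restrict0_in_dual assms(1) linear_betweenI) auto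

lemma dual_mult_bilinear:
  assumes U: "fin_dim_vspace U" and V: "fin_dim_vspace V" and W: "fin_dim_vspace W"
    and lin: "linear_between U (tensor_space V W) \<Delta>"
  shows "bilinear_between (dual_space V) (dual_space W) (dual_space U) (dual_mult U V W \<Delta>)"
proof -
  note bil = tensor_bilinear[OF V W linear_between_in[OF lin]]
  note add = fin_dim_dual[THEN fin_dim_add] and scale = fin_dim_dual[THEN fin_dim_scale]
  show ?thesis
  proof (intro bilinear_betweenI linear_betweenI)
    fix f g g' assume f: "f \<in> vcarrier (dual_space V)"
      and g: "g \<in> vcarrier (dual_space W)" "g' \<in> vcarrier (dual_space W)"
    have "dual_mult U V W \<Delta> f (g + g') u = dual_mult U V W \<Delta> f g u + dual_mult U V W \<Delta> f g' u"
      if "u \<in> vcarrier U" for u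
      using dual_mult_apply[OF V W lin f _ that] add[OF W] g
        linear_between_add[OF bilinear_between_right[OF bil[OF that] f] g] by simp
    then show "dual_mult U V W \<Delta> f (g + g') = dual_mult U V W \<Delta> f g + dual_mult U V W \<Delta> f g'"
      by (auto simp: fun_eq_iff dual_mult_def restrict0_def)
  next
    fix f g c assume f: "f \<in> vcarrier (dual_space V)" and g: "g \<in> vcarrier (dual_space W)"
    have "dual_mult U V W \<Delta> f (vscale (dual_space W) c g) u = c * dual_mult U V W \<Delta> f g u"
      if "u \<in> vcarrier U" for u
      using dual_mult_apply[OF V W lin f _ that] scale[OF W g] g
        linear_between_scale[OF bilinear_between_right[OF bil[OF that] f] g] by simp
    then show "dual_mult U V W \<Delta> f (vscale (dual_space W) c g) = vscale (dual_space U) c (dual_mult U V W \<Delta> f g)"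
      by (auto simp: fun_eq_iff dual_mult_def restrict0_def)
  next
    fix f f' g assume f: "f \<in> vcarrier (dual_space V)" "f' \<in> vcarrier (dual_space V)"
      and g: "g \<in> vcarrier (dual_space W)"
    have "dual_mult U V W \<Delta> (f + f') g u = dual_mult U V W \<Delta> f g u + dual_mult U V W \<Delta> f' g u"
      if "u \<in> vcarrier U" for u
      using dual_mult_apply[OF V W lin _ g that] add[OF V] f
        linear_between_add[OF bilinear_between_left[OF bil[OF that] g] f] by simp
    then show "dual_mult U V W \<Delta> (f + f') g = dual_mult U V W \<Delta> f g + dual_mult U V W \<Delta> f' g"
      by (auto simp: fun_eq_iff dual_mult_def restrict0_def)
  next
    fix f g c assume f: "f \<in> vcarrier (dual_space V)" and g: "g \<in> vcarrier (dual_space W)"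
    have "dual_mult U V W \<Delta> (vscale (dual_space V) c f) g u = c * dual_mult U V W \<Delta> f g u"
      if "u \<in> vcarrier U" for u
      using dual_mult_apply[OF V W lin _ g that] scale[OF V f] f
        linear_between_scale[OF bilinear_between_left[OF bil[OF that] g] f] by simp
    then show "dual_mult U V W \<Delta> (vscale (dual_space V) c f) g = vscale (dual_space U) c (dual_mult U V W \<Delta> f g)"
      by (auto simp: fun_eq_iff dual_mult_def restrict0_def)
  qed (simp_all add: dual_mult_in[OF U V W lin])
qed

text \<open>In finite dimension every functional on a dual space is an evaluation, so tests at
  evaluations are exhaustive.\<close>

lemma dual_tensor_eqI:
  assumes "fin_dim_vspace V" "fin_dim_vspace W"
    and "\<phi> \<in> vcarrier (tensor_space (dual_space V) (dual_space W))"
    and "\<psi> \<in> vcarrier (tensor_space (dual_space V) (dual_space W))"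
    and "\<And>v w. \<lbrakk>v \<in> vcarrier V; w \<in> vcarrier W\<rbrakk>
      \<Longrightarrow> \<phi> (dual_eval V v) (dual_eval W w) = \<psi> (dual_eval V v) (dual_eval W w)"
  shows "\<phi> = \<psi>"
  using assms
  by (intro tensor_eqI[OF fin_dim_dual fin_dim_dual]) (auto simp: dual_dual_carrier)

lemma dual_comult_exists:
  assumes V: "fin_dim_vspace V" and W: "fin_dim_vspace W" and U: "fin_dim_vspace U"
    and \<mu>: "bilinear_between V W U \<mu>" and f: "f \<in> vcarrier (dual_space U)"
  shows "\<exists>\<phi> \<in> vcarrier (tensor_space (dual_space V) (dual_space W)).
      \<forall>v\<in>vcarrier V. \<forall>w\<in>vcarrier W. \<phi> (dual_eval V v) (dual_eval W w) = f (\<mu> v w)"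
proof -
  obtain B x e C y d where B: "dual_basis V B x e" and C: "dual_basis W C y d"
    using dual_basis_exists V W by meson
  let ?T = "tensor_space (dual_space V) (dual_space W)"
  \<comment> \<open>The coordinates of the witness in the pure tensors of coordinate functionals are
    the structure constants of \<mu>, seen through \<open>f\<close>.\<close>
  let ?\<phi> = "\<Sum>b\<in>B. \<Sum>c\<in>C. vscale ?T (f (\<mu> (x b) (y c))) (pure_tensor (dual_space V) (dual_space W) (e b) (d c))"
  have T: "fin_dim_vspace ?T" using V W by simp
  have "?\<phi> \<in> vcarrier ?T"
    by (intro fin_dim_sum fin_dim_scale T pure_tensor_in dual_basisD(3)[OF B] dual_basisD(3)[OF C])
  moreover have "?\<phi> (dual_eval V v) (dual_eval W w) = f (\<mu> v w)"
    if v: "v \<in> vcarrier V" and w: "w \<in> vcarrier W" for v w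
  proof -
    have "?\<phi> (dual_eval V v) (dual_eval W w) = (\<Sum>b\<in>B. \<Sum>c\<in>C. vscale ground (e b v * d c w) (f (\<mu> (x b) (y c))))"
      using v w V W dual_basisD(3)[OF B] dual_basisD(3)[OF C]
      by (simp add: sum_fun_apply mult.commute)
    also have "\<dots> = f (\<mu> v w)"
      by (rule bilinear_expand[OF V W fin_dim_ground B C bilinear_between_compose[OF \<mu> dual_linear[OF f]] v w,
            symmetric])
    finally show ?thesis .
  qed
  ultimately show ?thesis by blast
qed

text \<open>Gives the definite description in \<open>dual_comult\<close> its meaning: existence
  comes from the explicit sum over bases, uniqueness from \<open>dual_tensor_eqI\<close>, once the
  pairing condition is read as evaluation at vectors.\<close>

lemma
  assumes V: "fin_dim_vspace V" and W: "fin_dim_vspace W" and U: "fin_dim_vspace U"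
    and \<mu>: "bilinear_between V W U \<mu>" and f: "f \<in> vcarrier (dual_space U)"
  shows dual_comult_in: "dual_comult V W \<mu> f \<in> vcarrier (tensor_space (dual_space V) (dual_space W))"
    and dual_comult_apply: "\<lbrakk>v \<in> vcarrier V; w \<in> vcarrier W\<rbrakk>
      \<Longrightarrow> dual_comult V W \<mu> f (dual_eval V v) (dual_eval W w) = f (\<mu> v w)"
proof -
  let ?P = "\<lambda>\<phi>. \<phi> \<in> vcarrier (tensor_space (dual_space V) (dual_space W)) \<and>
    (\<forall>v\<in>vcarrier V. \<forall>w\<in>vcarrier W. tensor_pairing V W \<phi> (pure_tensor V W v w) = f (\<mu> v w))"
  have P: "?P \<phi> \<longleftrightarrow> \<phi> \<in> vcarrier (tensor_space (dual_space V) (dual_space W)) \<and>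
    (\<forall>v\<in>vcarrier V. \<forall>w\<in>vcarrier W. \<phi> (dual_eval V v) (dual_eval W w) = f (\<mu> v w))" for \<phi>
    using tensor_pairing_pure_right[OF V W] by auto
  have "\<exists>!\<phi>. ?P \<phi>"
    unfolding P
  proof (rule ex_ex1I)
    show "\<exists>\<phi>. \<phi> \<in> vcarrier (tensor_space (dual_space V) (dual_space W)) \<and>
      (\<forall>v\<in>vcarrier V. \<forall>w\<in>vcarrier W. \<phi> (dual_eval V v) (dual_eval W w) = f (\<mu> v w))"
      using dual_comult_exists[OF assms] by blast
  qed (rule dual_tensor_eqI[OF V W], auto)
  then have "?P (dual_comult V W \<mu> f)" unfolding dual_comult_def by (rule theI')
  then show "dual_comult V W \<mu> f \<in> vcarrier (tensor_space (dual_space V) (dual_space W))"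
    and "\<lbrakk>v \<in> vcarrier V; w \<in> vcarrier W\<rbrakk>
      \<Longrightarrow> dual_comult V W \<mu> f (dual_eval V v) (dual_eval W w) = f (\<mu> v w)"
    unfolding P by auto
qed

lemma dual_comult_linear:
  assumes V: "fin_dim_vspace V" and W: "fin_dim_vspace W" and U: "fin_dim_vspace U"
    and \<mu>: "bilinear_between V W U \<mu>"
  shows "linear_between (dual_space U) (tensor_space (dual_space V) (dual_space W)) (dual_comult V W \<mu>)"
proof (rule linear_betweenI)
  have T: "fin_dim_vspace (tensor_space (dual_space V) (dual_space W))" using V W by simp
  note dc_in = dual_comult_in[OF assms] and dc_apply = dual_comult_apply[OF assms]
  show "dual_comult V W \<mu> f \<in> vcarrier (tensor_space (dual_space V) (dual_space W))"
    if "f \<in> vcarrier (dual_space U)" for f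
    using that by (rule dc_in)
  show "dual_comult V W \<mu> (f + g) = dual_comult V W \<mu> f + dual_comult V W \<mu> g"
    if f: "f \<in> vcarrier (dual_space U)" and g: "g \<in> vcarrier (dual_space U)" for f g
  proof (rule dual_tensor_eqI[OF V W])
    have fg: "f + g \<in> vcarrier (dual_space U)" using f g U by simp
    show "dual_comult V W \<mu> (f + g) \<in> vcarrier (tensor_space (dual_space V) (dual_space W))"
      using fg by (rule dc_in)
    show "dual_comult V W \<mu> f + dual_comult V W \<mu> g \<in> vcarrier (tensor_space (dual_space V) (dual_space W))"
      using f g by (intro fin_dim_add T dc_in)
    show "dual_comult V W \<mu> (f + g) (dual_eval V v) (dual_eval W w) =
        (dual_comult V W \<mu> f + dual_comult V W \<mu> g) (dual_eval V v) (dual_eval W w)"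
      if "v \<in> vcarrier V" "w \<in> vcarrier W" for v w
      using that by (simp add: dc_apply f g fg)
  qed
  show "dual_comult V W \<mu> (vscale (dual_space U) c f) =
      vscale (tensor_space (dual_space V) (dual_space W)) c (dual_comult V W \<mu> f)"
    if f: "f \<in> vcarrier (dual_space U)" for f c
  proof (rule dual_tensor_eqI[OF V W])
    have cf: "vscale (dual_space U) c f \<in> vcarrier (dual_space U)" using f fin_dim_dual[OF U] by (rule fin_dim_scale[rotated])
    show "dual_comult V W \<mu> (vscale (dual_space U) c f) \<in> vcarrier (tensor_space (dual_space V) (dual_space W))"
      using cf by (rule dc_in)
    show "vscale (tensor_space (dual_space V) (dual_space W)) c (dual_comult V W \<mu> f)
        \<in> vcarrier (tensor_space (dual_space V) (dual_space W))"
      using f by (intro fin_dim_scale T dc_in)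
    show "dual_comult V W \<mu> (vscale (dual_space U) c f) (dual_eval V v) (dual_eval W w) =
        vscale (tensor_space (dual_space V) (dual_space W)) c (dual_comult V W \<mu> f) (dual_eval V v) (dual_eval W w)"
      if "v \<in> vcarrier V" "w \<in> vcarrier W" for v w
      using dc_apply[OF cf that] dc_apply[OF f that] by simp
  qed
qed

text \<open>Transposing a product twice returns it up to \<open>dual_eval\<close>. The two products
  and the two actions of the double dual are all instances.\<close>

lemma dual_mult_dual_comult:
  assumes V: "fin_dim_vspace V" and W: "fin_dim_vspace W" and U: "fin_dim_vspace U"
    and \<mu>: "bilinear_between V W U \<mu>" and v: "v \<in> vcarrier V" and w: "w \<in> vcarrier W"
  shows "dual_mult (dual_space U) (dual_space V) (dual_space W) (dual_comult V W \<mu>)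
      (dual_eval V v) (dual_eval W w) = dual_eval U (\<mu> v w)"
  using assms
  by (subst dual_mult_eq) (auto simp: dual_eval_def[of U] dual_comult_apply dual_comult_linear
      intro!: restrict0_cong)

section \<open>Transposing the axioms\<close>

text \<open>At f and g \<otimes> h, the left tensor takes the value of (fg)h at x and the right one
  that of f(gh). Six independent spaces are allowed so that one statement covers the coassociativity
  of \<open>comultm1\<close> and \<open>comult0'\<close> as well as the three mixed laws.\<close>

lemma coassoc_iff:
  assumes X: "fin_dim_vspace X" and P: "fin_dim_vspace P" and Q: "fin_dim_vspace Q"
    and U: "fin_dim_vspace U" and V: "fin_dim_vspace V" and W: "fin_dim_vspace W"
    and \<Delta>: "linear_between X (tensor_space P W) \<Delta>" and \<Gamma>: "linear_between P (tensor_space U V) \<Gamma>"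
    and \<Delta>': "linear_between X (tensor_space U Q) \<Delta>'" and \<Gamma>': "linear_between Q (tensor_space V W) \<Gamma>'"
  shows "(\<forall>x\<in>vcarrier X. tensor_assoc U V W (tensor_map P W (tensor_space U V) W \<Gamma> id (\<Delta> x)) =
        tensor_map U Q U (tensor_space V W) id \<Gamma>' (\<Delta>' x)) \<longleftrightarrow>
    (\<forall>f\<in>vcarrier (dual_space U). \<forall>g\<in>vcarrier (dual_space V). \<forall>h\<in>vcarrier (dual_space W).
       dual_mult X P W \<Delta> (dual_mult P U V \<Gamma> f g) h = dual_mult X U Q \<Delta>' f (dual_mult Q V W \<Gamma>' g h))"
    (is "(\<forall>x\<in>_. ?L x = ?R x) \<longleftrightarrow> (\<forall>f\<in>_. \<forall>g\<in>_. \<forall>h\<in>_. ?l f g h = ?r f g h)")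
proof -
  have UV: "fin_dim_vspace (tensor_space U V)" and VW: "fin_dim_vspace (tensor_space V W)"
    using U V W by simp_all
  have map_in: "tensor_map P W (tensor_space U V) W \<Gamma> id (\<Delta> x) \<in> vcarrier (tensor_space (tensor_space U V) W)"
    if "x \<in> vcarrier X" for x
    by (intro tensor_map_in P W UV \<Gamma> linear_between_id linear_between_in[OF \<Delta> that])
  have L_in: "?L x \<in> vcarrier (tensor_space U (tensor_space V W))" if "x \<in> vcarrier X" for x
    by (intro tensor_assoc_in U V W map_in that)
  have R_in: "?R x \<in> vcarrier (tensor_space U (tensor_space V W))" if "x \<in> vcarrier X" for x
    by (intro tensor_map_in U Q VW \<Gamma>' linear_between_id linear_between_in[OF \<Delta>' that])
  have mult_in: "dual_mult P U V \<Gamma> f g \<in> vcarrier (dual_space P)"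
    if "f \<in> vcarrier (dual_space U)" "g \<in> vcarrier (dual_space V)" for f g
    using that by (intro dual_mult_in P U V \<Gamma>)
  have mult_in': "dual_mult Q V W \<Gamma>' g h \<in> vcarrier (dual_space Q)"
    if "g \<in> vcarrier (dual_space V)" "h \<in> vcarrier (dual_space W)" for g h
    using that by (intro dual_mult_in Q V W \<Gamma>')
  have L: "?L x f (tensor_eval V W g h) = ?l f g h x" and R: "?R x f (tensor_eval V W g h) = ?r f g h x"
    if x: "x \<in> vcarrier X" and f: "f \<in> vcarrier (dual_space U)" and g: "g \<in> vcarrier (dual_space V)"
      and h: "h \<in> vcarrier (dual_space W)" for x f g h
  proof -
    \<comment> \<open>The functional f \<otimes> g pulled back along \<Gamma> is the inner product
      fg; the other bracket is treated in the same way with \<Gamma>'.\<close>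
    have "restrict0 P (\<lambda>p. tensor_eval U V f g (\<Gamma> p)) = dual_mult P U V \<Gamma> f g"
      unfolding dual_mult_eq[OF U V \<Gamma> f g] by (intro restrict0_cong) (simp add: linear_between_in[OF \<Gamma>])
    then show "?L x f (tensor_eval V W g h) = ?l f g h x"
      using tensor_assoc_apply[OF U V W map_in[OF x] f g h]
        tensor_map_apply[OF P W UV W \<Gamma> linear_between_id(1) linear_between_in[OF \<Delta> x]
          tensor_eval_in[OF U V] h]
        dual_mult_apply[OF P W \<Delta> mult_in[OF f g] h x]
      by (simp add: restrict0_dual h)
    have "restrict0 Q (\<lambda>q. tensor_eval V W g h (\<Gamma>' q)) = dual_mult Q V W \<Gamma>' g h"
      unfolding dual_mult_eq[OF V W \<Gamma>' g h] by (intro restrict0_cong) (simp add: linear_between_in[OF \<Gamma>'])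
    then show "?R x f (tensor_eval V W g h) = ?r f g h x"
      using tensor_map_apply[OF U Q U VW linear_between_id(1) \<Gamma>' linear_between_in[OF \<Delta>' x] f
          tensor_eval_in[OF V W]]
        dual_mult_apply[OF U Q \<Delta>' f mult_in'[OF g h] x]
      by (simp add: restrict0_dual f)
  qed
  show ?thesis
  proof (intro iffI ballI)
    fix f g h assume eq: "\<forall>x\<in>vcarrier X. ?L x = ?R x"
      and f: "f \<in> vcarrier (dual_space U)" and g: "g \<in> vcarrier (dual_space V)" and h: "h \<in> vcarrier (dual_space W)"
    show "?l f g h = ?r f g h"
    proof (rule dual_eqI)
      show "?l f g h \<in> vcarrier (dual_space X)" by (intro dual_mult_in X P W \<Delta> mult_in f g h)
      show "?r f g h \<in> vcarrier (dual_space X)" by (intro dual_mult_in X U Q \<Delta>' mult_in' f g h)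
      show "?l f g h x = ?r f g h x" if "x \<in> vcarrier X" for x
        using L[OF that f g h] R[OF that f g h] eq that by simp
    qed
  next
    fix x assume eq: "\<forall>f\<in>vcarrier (dual_space U). \<forall>g\<in>vcarrier (dual_space V). \<forall>h\<in>vcarrier (dual_space W).
        ?l f g h = ?r f g h" and x: "x \<in> vcarrier X"
    show "?L x = ?R x"
      using L[OF x] R[OF x] eq by (intro tensor3_eqI[OF U V W L_in[OF x] R_in[OF x]]) simp
  qed
qed

text \<open>With \<open>t\<close> the structure map this serves the law that t respects the
  comultiplications and both components of the law for \<Delta>_0 t. With \<open>t\<close> the
  identity it serves the two descriptions of \<open>comult0'\<close> through \<open>comult0l\<close>
  and \<open>comult0r\<close>.\<close>

lemma comult_hom_iff:
  assumes Y: "fin_dim_vspace Y" and Z: "fin_dim_vspace Z" and U: "fin_dim_vspace U" and U': "fin_dim_vspace U'"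
    and V: "fin_dim_vspace V" and V': "fin_dim_vspace V'"
    and \<Theta>: "linear_between Z (tensor_space U U') \<Theta>" and t: "linear_between Y Z t"
    and \<Delta>: "linear_between Y (tensor_space V V') \<Delta>" and S: "linear_between V U S" and T: "linear_between V' U' T"
  shows "(\<forall>y\<in>vcarrier Y. \<Theta> (t y) = tensor_map V V' U U' S T (\<Delta> y)) \<longleftrightarrow>
    (\<forall>f\<in>vcarrier (dual_space U). \<forall>g\<in>vcarrier (dual_space U').
       restrict0 Y (\<lambda>y. dual_mult Z U U' \<Theta> f g (t y)) =
       dual_mult Y V V' \<Delta> (restrict0 V (\<lambda>v. f (S v))) (restrict0 V' (\<lambda>v. g (T v))))"
    (is "(\<forall>y\<in>_. ?L y = ?R y) \<longleftrightarrow> (\<forall>f\<in>_. \<forall>g\<in>_. ?l f g = ?r f g)")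
proof -
  have L_in: "?L y \<in> vcarrier (tensor_space U U')" if "y \<in> vcarrier Y" for y
    by (intro linear_between_in[OF \<Theta>] linear_between_in[OF t] that)
  have R_in: "?R y \<in> vcarrier (tensor_space U U')" if "y \<in> vcarrier Y" for y
    by (intro tensor_map_in V V' U U' S T linear_between_in[OF \<Delta> that])
  have S_in: "restrict0 V (\<lambda>v. f (S v)) \<in> vcarrier (dual_space V)" if "f \<in> vcarrier (dual_space U)" for f
    by (intro restrict0_in_dual V linear_between_compose[OF S dual_linear[OF that]])
  have T_in: "restrict0 V' (\<lambda>v. g (T v)) \<in> vcarrier (dual_space V')" if "g \<in> vcarrier (dual_space U')" for g
    by (intro restrict0_in_dual V' linear_between_compose[OF T dual_linear[OF that]])
  have L: "?L y f g = ?l f g y" and R: "?R y f g = ?r f g y"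
    if y: "y \<in> vcarrier Y" and f: "f \<in> vcarrier (dual_space U)" and g: "g \<in> vcarrier (dual_space U')" for y f g
    using dual_mult_apply[OF U U' \<Theta> f g linear_between_in[OF t y]]
      tensor_map_apply[OF V V' U U' S T linear_between_in[OF \<Delta> y] f g]
      dual_mult_apply[OF V V' \<Delta> S_in[OF f] T_in[OF g] y] y by simp_all
  show ?thesis
  proof (intro iffI ballI)
    fix f g assume eq: "\<forall>y\<in>vcarrier Y. ?L y = ?R y"
      and f: "f \<in> vcarrier (dual_space U)" and g: "g \<in> vcarrier (dual_space U')"
    show "?l f g = ?r f g"
    proof (rule dual_eqI)
      show "?l f g \<in> vcarrier (dual_space Y)"
        by (intro restrict0_in_dual Y linear_between_compose[OF t dual_linear] dual_mult_in Z U U' \<Theta> f g)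
      show "?r f g \<in> vcarrier (dual_space Y)" by (intro dual_mult_in Y V V' \<Delta> S_in T_in f g)
      show "?l f g y = ?r f g y" if "y \<in> vcarrier Y" for y
        using L[OF that f g] R[OF that f g] eq that by simp
    qed
  next
    fix y assume eq: "\<forall>f\<in>vcarrier (dual_space U). \<forall>g\<in>vcarrier (dual_space U'). ?l f g = ?r f g"
      and y: "y \<in> vcarrier Y"
    show "?L y = ?R y"
      using L[OF y] R[OF y] eq by (intro tensor_eqI[OF U U' L_in[OF y] R_in[OF y]]) simp
  qed
qed

text \<open>A functional \<open>g\<close> applied to the contracted comultiplication of x is the
  value at x of the dual product of the counit with \<open>g\<close>; functionals separate
  points.\<close>

lemma counit_left_iff:
  assumes V: "fin_dim_vspace V" and X: "fin_dim_vspace X"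
    and \<Delta>: "linear_between X (tensor_space V X) \<Delta>" and \<epsilon>: "linear_between V ground \<epsilon>"
  shows "(\<forall>x\<in>vcarrier X. tensor_lift V X (\<lambda>v z. vscale X (\<epsilon> v) z) (\<Delta> x) = x) \<longleftrightarrow>
    (\<forall>g\<in>vcarrier (dual_space X). dual_mult X V X \<Delta> (restrict0 V \<epsilon>) g = g)"
    (is "(\<forall>x\<in>_. ?L x = x) \<longleftrightarrow> (\<forall>g\<in>_. ?l g = g)")
proof -
  note \<epsilon>_in = restrict0_in_dual[OF V \<epsilon>]
  have L: "g (?L x) = ?l g x" if "x \<in> vcarrier X" "g \<in> vcarrier (dual_space X)" for g x
    using contract_left_apply[OF V X \<epsilon> linear_between_in[OF \<Delta> that(1)] that(2)]
      dual_mult_apply[OF V X \<Delta> \<epsilon>_in that(2,1)] by simp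
  show ?thesis
  proof (intro iffI ballI)
    fix g assume eq: "\<forall>x\<in>vcarrier X. ?L x = x" and g: "g \<in> vcarrier (dual_space X)"
    show "?l g = g"
      using eq L[OF _ g] by (intro dual_eqI[OF dual_mult_in[OF X V X \<Delta> \<epsilon>_in g] g]) simp
  next
    fix x assume eq: "\<forall>g\<in>vcarrier (dual_space X). ?l g = g" and x: "x \<in> vcarrier X"
    show "?L x = x"
      using eq L[OF x] by (intro dual_separates[OF X contract_left_in[OF V X \<epsilon> linear_between_in[OF \<Delta> x]] x]) simp
  qed
qed

lemma counit_right_iff:
  assumes V: "fin_dim_vspace V" and X: "fin_dim_vspace X"
    and \<Delta>: "linear_between X (tensor_space X V) \<Delta>" and \<epsilon>: "linear_between V ground \<epsilon>"
  shows "(\<forall>x\<in>vcarrier X. tensor_lift X V (\<lambda>z v. vscale X (\<epsilon> v) z) (\<Delta> x) = x) \<longleftrightarrow>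
    (\<forall>g\<in>vcarrier (dual_space X). dual_mult X X V \<Delta> g (restrict0 V \<epsilon>) = g)"
    (is "(\<forall>x\<in>_. ?L x = x) \<longleftrightarrow> (\<forall>g\<in>_. ?l g = g)")
proof -
  note \<epsilon>_in = restrict0_in_dual[OF V \<epsilon>]
  have L: "g (?L x) = ?l g x" if "x \<in> vcarrier X" "g \<in> vcarrier (dual_space X)" for g x
    using contract_right_apply[OF X V \<epsilon> linear_between_in[OF \<Delta> that(1)] that(2)]
      dual_mult_apply[OF X V \<Delta> that(2) \<epsilon>_in that(1)] by simp
  show ?thesis
  proof (intro iffI ballI)
    fix g assume eq: "\<forall>x\<in>vcarrier X. ?L x = x" and g: "g \<in> vcarrier (dual_space X)"
    show "?l g = g"
      using eq L[OF _ g] by (intro dual_eqI[OF dual_mult_in[OF X X V \<Delta> g \<epsilon>_in] g]) simp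
  next
    fix x assume eq: "\<forall>g\<in>vcarrier (dual_space X). ?l g = g" and x: "x \<in> vcarrier X"
    show "?L x = x"
      using eq L[OF x] by (intro dual_separates[OF X contract_right_in[OF X V \<epsilon> linear_between_in[OF \<Delta> x]] x]) simp
  qed
qed

lemma
  assumes V: "fin_dim_vspace V" and V': "fin_dim_vspace V'" and W: "fin_dim_vspace W" and W': "fin_dim_vspace W'"
    and U: "fin_dim_vspace U" and U': "fin_dim_vspace U'"
    and \<beta>: "bilinear_between V W U \<beta>" and \<gamma>: "bilinear_between V' W' U' \<gamma>"
    and p: "p \<in> vcarrier (tensor_space V V')" and q: "q \<in> vcarrier (tensor_space W W')"
  shows tensor_mult_in: "tensor_mult V V' W W' U U' \<beta> \<gamma> p q \<in> vcarrier (tensor_space U U')"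
    and tensor_mult_apply_expand:
      "\<lbrakk>dual_basis V B x e; dual_basis V' B' x' e'; dual_basis W C y d; dual_basis W' C' y' d';
        f \<in> vcarrier (dual_space U); g \<in> vcarrier (dual_space U')\<rbrakk> \<Longrightarrow>
       tensor_mult V V' W W' U U' \<beta> \<gamma> p q f g =
       (\<Sum>b\<in>B. \<Sum>b'\<in>B'. \<Sum>c\<in>C. \<Sum>c'\<in>C'.
          p (e b) (e' b') * q (d c) (d' c') * (f (\<beta> (x b) (y c)) * g (\<gamma> (x' b') (y' c'))))"
proof -
  let ?\<kappa> = "\<lambda>v v' w w'. pure_tensor U U' (\<beta> v w) (\<gamma> v' w')"
  note P = pure_tensor_bilinear[OF U U']
  have T: "fin_dim_vspace (tensor_space U U')" using U U' by simp
  have \<kappa>: "bilinear_between W W' (tensor_space U U') (?\<kappa> v v')" if "v \<in> vcarrier V" "v' \<in> vcarrier V'" for v v'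
    using bilinear_between_precompose[OF P bilinear_between_right[OF \<beta> that(1)] bilinear_between_right[OF \<gamma> that(2)]] .
  have \<kappa>': "bilinear_between V V' (tensor_space U U') (\<lambda>v v'. ?\<kappa> v v' w w')"
    if "w \<in> vcarrier W" "w' \<in> vcarrier W'" for w w'
    using bilinear_between_precompose[OF P bilinear_between_left[OF \<beta> that(1)] bilinear_between_left[OF \<gamma> that(2)]] .
  \<comment> \<open>The outer lift can be expanded only because the inner one, at the fixed tensor
    \<open>q\<close>, is bilinear in \<open>v\<close> and \<open>v'\<close>.\<close>
  have bil: "bilinear_between V V' (tensor_space U U') (\<lambda>v v'. tensor_lift W W' (?\<kappa> v v') q)"
  proof (intro bilinear_betweenI)
    fix v assume v: "v \<in> vcarrier V"
    show "linear_between V' (tensor_space U U') (\<lambda>v'. tensor_lift W W' (?\<kappa> v v') q)"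
      by (rule tensor_lift_param_linear[OF W W' T V' q \<kappa>[OF v]])
         (use bilinear_between_right[OF \<kappa>' v] in simp_all)
  next
    fix v' assume v': "v' \<in> vcarrier V'"
    show "linear_between V (tensor_space U U') (\<lambda>v. tensor_lift W W' (?\<kappa> v v') q)"
      by (rule tensor_lift_param_linear[OF W W' T V q \<kappa>[OF _ v']])
         (use bilinear_between_left[OF \<kappa>' v'] in simp_all)
  qed
  show "tensor_mult V V' W W' U U' \<beta> \<gamma> p q \<in> vcarrier (tensor_space U U')"
    unfolding tensor_mult_def by (rule linear_between_in[OF tensor_lift_linear[OF V V' T bil] p])
  assume B: "dual_basis V B x e" and B': "dual_basis V' B' x' e'" and C: "dual_basis W C y d"
    and C': "dual_basis W' C' y' d'" and f: "f \<in> vcarrier (dual_space U)" and g: "g \<in> vcarrier (dual_space U')"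
  have "tensor_mult V V' W W' U U' \<beta> \<gamma> p q f g =
      (\<Sum>b\<in>B. \<Sum>b'\<in>B'. p (e b) (e' b') * tensor_lift W W' (?\<kappa> (x b) (x' b')) q f g)"
    unfolding tensor_mult_def tensor_lift_expand[OF V V' T B B' bil p] by (simp add: sum_fun_apply)
  also have "\<dots> = (\<Sum>b\<in>B. \<Sum>b'\<in>B'. p (e b) (e' b') * (\<Sum>c\<in>C. \<Sum>c'\<in>C'.
      q (d c) (d' c') * (f (\<beta> (x b) (y c)) * g (\<gamma> (x' b') (y' c')))))"
    using f g
    by (intro sum.cong refl arg_cong2[where f = "(*)"])
       (simp add: tensor_lift_expand[OF W W' T C C' \<kappa> q] dual_basisD(2)[OF B] dual_basisD(2)[OF B'] sum_fun_apply)
  finally show "tensor_mult V V' W W' U U' \<beta> \<gamma> p q f g =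
       (\<Sum>b\<in>B. \<Sum>b'\<in>B'. \<Sum>c\<in>C. \<Sum>c'\<in>C'.
          p (e b) (e' b') * q (d c) (d' c') * (f (\<beta> (x b) (y c)) * g (\<gamma> (x' b') (y' c'))))"
    by (simp add: sum_distrib_left mult.assoc)
qed

text \<open>The condition is self-dual: the pair \<Delta>, \<Gamma> trades places with the pair
  \<beta>, \<gamma>, and \<Theta> with \<mu>. The inner factors \<open>V'\<close> and
  \<open>W\<close> are interchanged, the usual middle flip of a bialgebra axiom. Independent spaces
  let one statement serve the conditions for the actions and those for the product.\<close>

lemma compatible_iff:
  assumes X: "fin_dim_vspace X" and Y: "fin_dim_vspace Y" and Z: "fin_dim_vspace Z"
    and V: "fin_dim_vspace V" and V': "fin_dim_vspace V'" and W: "fin_dim_vspace W" and W': "fin_dim_vspace W'"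
    and U: "fin_dim_vspace U" and U': "fin_dim_vspace U'"
    and \<Delta>: "linear_between X (tensor_space V V') \<Delta>" and \<Gamma>: "linear_between Y (tensor_space W W') \<Gamma>"
    and \<Theta>: "linear_between Z (tensor_space U U') \<Theta>"
    and \<mu>: "bilinear_between X Y Z \<mu>"
    and \<beta>: "bilinear_between V W U \<beta>" and \<gamma>: "bilinear_between V' W' U' \<gamma>"
  shows "(\<forall>x\<in>vcarrier X. \<forall>y\<in>vcarrier Y.
        \<Theta> (\<mu> x y) = tensor_mult V V' W W' U U' \<beta> \<gamma> (\<Delta> x) (\<Gamma> y)) \<longleftrightarrow>
    (\<forall>f\<in>vcarrier (dual_space U). \<forall>g\<in>vcarrier (dual_space U').
       dual_comult X Y \<mu> (dual_mult Z U U' \<Theta> f g) =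
       tensor_mult (dual_space V) (dual_space W) (dual_space V') (dual_space W') (dual_space X) (dual_space Y)
         (dual_mult X V V' \<Delta>) (dual_mult Y W W' \<Gamma>) (dual_comult V W \<beta> f) (dual_comult V' W' \<gamma> g))"
    (is "(\<forall>x\<in>_. \<forall>y\<in>_. ?L x y = ?R x y) \<longleftrightarrow> (\<forall>f\<in>_. \<forall>g\<in>_. ?l f g = ?r f g)")
proof -
  note \<Delta>_in = linear_between_in[OF \<Delta>] and \<Gamma>_in = linear_between_in[OF \<Gamma>]
    and \<mu>_in = bilinear_between_in[OF \<mu>] and \<Theta>_in = linear_between_in[OF \<Theta>]
  have L_in: "?L x y \<in> vcarrier (tensor_space U U')" if "x \<in> vcarrier X" "y \<in> vcarrier Y" for x y
    by (intro \<Theta>_in \<mu>_in that)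
  have R_in: "?R x y \<in> vcarrier (tensor_space U U')" if "x \<in> vcarrier X" "y \<in> vcarrier Y" for x y
    by (intro tensor_mult_in V V' W W' U U' \<beta> \<gamma> \<Delta>_in \<Gamma>_in that)
  have l_in: "?l f g \<in> vcarrier (tensor_space (dual_space X) (dual_space Y))"
    if "f \<in> vcarrier (dual_space U)" "g \<in> vcarrier (dual_space U')" for f g
    by (intro dual_comult_in[OF X Y Z \<mu>] dual_mult_in Z U U' \<Theta> that)
  have r_in: "?r f g \<in> vcarrier (tensor_space (dual_space X) (dual_space Y))"
    if "f \<in> vcarrier (dual_space U)" "g \<in> vcarrier (dual_space U')" for f g
    by (intro tensor_mult_in fin_dim_dual X Y V V' W W' dual_mult_bilinear \<Delta> \<Gamma>
        dual_comult_in[OF V W U \<beta>] dual_comult_in[OF V' W' U' \<gamma>] that)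
  have L: "?L x y f g = ?l f g (dual_eval X x) (dual_eval Y y)"
    and R: "?R x y f g = ?r f g (dual_eval X x) (dual_eval Y y)"
    if x: "x \<in> vcarrier X" and y: "y \<in> vcarrier Y"
      and f: "f \<in> vcarrier (dual_space U)" and g: "g \<in> vcarrier (dual_space U')" for x y f g
  proof -
    show "?L x y f g = ?l f g (dual_eval X x) (dual_eval Y y)"
      using dual_comult_apply[OF X Y Z \<mu> dual_mult_in[OF Z U U' \<Theta> f g] x y]
        dual_mult_apply[OF U U' \<Theta> f g \<mu>_in[OF x y]] by simp
    obtain B a e where B: "dual_basis V B a e" using dual_basis_exists V by blast
    obtain B' a' e' where B': "dual_basis V' B' a' e'" using dual_basis_exists V' by blast
    obtain C b d where C: "dual_basis W C b d" using dual_basis_exists W by blast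
    obtain C' b' d' where C': "dual_basis W' C' b' d'" using dual_basis_exists W' by blast
    have "?R x y f g = (\<Sum>i\<in>B. \<Sum>i'\<in>B'. \<Sum>j\<in>C. \<Sum>j'\<in>C'.
        \<Delta> x (e i) (e' i') * \<Gamma> y (d j) (d' j') * (f (\<beta> (a i) (b j)) * g (\<gamma> (a' i') (b' j'))))"
      by (rule tensor_mult_apply_expand[OF V V' W W' U U' \<beta> \<gamma> \<Delta>_in[OF x] \<Gamma>_in[OF y] B B' C C' f g])
    \<comment> \<open>The middle flip, in coordinates an exchange of the sums over \<open>B'\<close>
      and \<open>C\<close>.\<close>
    also have "\<dots> = (\<Sum>i\<in>B. \<Sum>j\<in>C. \<Sum>i'\<in>B'. \<Sum>j'\<in>C'.
        \<Delta> x (e i) (e' i') * \<Gamma> y (d j) (d' j') * (f (\<beta> (a i) (b j)) * g (\<gamma> (a' i') (b' j'))))"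
      by (intro sum.cong refl sum.swap)
    \<comment> \<open>Each factor is now a structure constant of the dual: values of \<Delta> and
      \<Gamma> come from dual products, values of \<open>f\<close> and \<open>g\<close> on products
      are coordinates of dual comultiplications.\<close>
    also have "\<dots> = (\<Sum>i\<in>B. \<Sum>j\<in>C. \<Sum>i'\<in>B'. \<Sum>j'\<in>C'.
        dual_comult V W \<beta> f (dual_eval V (a i)) (dual_eval W (b j)) *
        dual_comult V' W' \<gamma> g (dual_eval V' (a' i')) (dual_eval W' (b' j')) *
        (dual_eval X x (dual_mult X V V' \<Delta> (e i) (e' i')) * dual_eval Y y (dual_mult Y W W' \<Gamma> (d j) (d' j'))))"
      by (intro sum.cong refl)
         (simp add: dual_comult_apply[OF V W U \<beta> f] dual_comult_apply[OF V' W' U' \<gamma> g]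
           dual_basisD(2,3)[OF B] dual_basisD(2,3)[OF B'] dual_basisD(2,3)[OF C] dual_basisD(2,3)[OF C']
           dual_mult_in[OF X V V' \<Delta>] dual_mult_in[OF Y W W' \<Gamma>]
           dual_mult_apply[OF V V' \<Delta> _ _ x] dual_mult_apply[OF W W' \<Gamma> _ _ y])
    \<comment> \<open>The same expansion read backwards over the dual spaces, with the coordinate
      functionals as bases and evaluations as their coordinates.\<close>
    also have "\<dots> = ?r f g (dual_eval X x) (dual_eval Y y)"
      by (rule tensor_mult_apply_expand[symmetric])
         (intro fin_dim_dual X Y V V' W W' dual_mult_bilinear \<Delta> \<Gamma>
           dual_comult_in[OF V W U \<beta> f] dual_comult_in[OF V' W' U' \<gamma> g]
           dual_basis_dual B B' C C' dual_eval_in x y)+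
    finally show "?R x y f g = ?r f g (dual_eval X x) (dual_eval Y y)" .
  qed
  show ?thesis
  proof (intro iffI ballI)
    fix f g assume eq: "\<forall>x\<in>vcarrier X. \<forall>y\<in>vcarrier Y. ?L x y = ?R x y"
      and f: "f \<in> vcarrier (dual_space U)" and g: "g \<in> vcarrier (dual_space U')"
    show "?l f g = ?r f g"
      using L[OF _ _ f g] R[OF _ _ f g] eq by (intro dual_tensor_eqI[OF X Y l_in[OF f g] r_in[OF f g]]) simp
  next
    fix x y assume eq: "\<forall>f\<in>vcarrier (dual_space U). \<forall>g\<in>vcarrier (dual_space U'). ?l f g = ?r f g"
      and x: "x \<in> vcarrier X" and y: "y \<in> vcarrier Y"
    show "?L x y = ?R x y"
      using L[OF x y] R[OF x y] eq by (intro tensor_eqI[OF U U' L_in[OF x y] R_in[OF x y]]) simp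
  qed
qed

section \<open>Duality of associative 2-bialgebras\<close>

lemma dual_2_struct_sel:
  "deg0 (dual_2_struct G) = dual_space (degm1 G)"
  "degm1 (dual_2_struct G) = dual_space (deg0 G)"
  "tmap (dual_2_struct G) = (\<lambda>g. restrict0 (degm1 G) (\<lambda>y. g (tmap G y)))"
  "mult0 (dual_2_struct G) = dual_mult (degm1 G) (degm1 G) (degm1 G) (comultm1 G)"
  "multm1 (dual_2_struct G) = dual_mult (deg0 G) (deg0 G) (deg0 G) (comult0' G)"
  "lact (dual_2_struct G) = dual_mult (deg0 G) (degm1 G) (deg0 G) (comult0l G)"
  "ract (dual_2_struct G) = dual_mult (deg0 G) (deg0 G) (degm1 G) (comult0r G)"
  "comultm1 (dual_2_struct G) = dual_comult (deg0 G) (deg0 G) (mult0 G)"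
  "comult0l (dual_2_struct G) = dual_comult (deg0 G) (degm1 G) (lact G)"
  "comult0r (dual_2_struct G) = dual_comult (degm1 G) (deg0 G) (ract G)"
  "comult0' (dual_2_struct G) = dual_comult (degm1 G) (degm1 G) (multm1 G)"
  by (simp_all add: dual_2_struct_def)

lemma dual_2_struct_tmap: "tmap (dual_2_struct G) g = restrict0 (degm1 G) (\<lambda>y. g (tmap G y))"
  by (simp add: dual_2_struct_def)

lemma dual_2_units_sel:
  "unit0 (dual_2_units G u) = restrict0 (degm1 G) (counitm1 u)"
  "unitm1 (dual_2_units G u) = restrict0 (deg0 G) (counit0 u)"
  "counit0 (dual_2_units G u) = (\<lambda>f. f (unitm1 u))"
  "counitm1 (dual_2_units G u) = (\<lambda>g. g (unit0 u))"
  by (simp_all add: dual_2_units_def)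

lemma tmap_dual_linear:
  assumes "fin_dim_vspace V" "fin_dim_vspace W" "linear_between V W t"
  shows "linear_between (dual_space W) (dual_space V) (\<lambda>g. restrict0 V (\<lambda>v. g (t v)))"
  using assms
  by (intro linear_betweenI restrict0_in_dual linear_between_compose[OF assms(3)] dual_linear)
     (auto simp: restrict0_def fun_eq_iff)

lemma two_algebra_data_dual:
  assumes "two_coalgebra_data G" shows "two_algebra_data (dual_2_struct G)"
  using assms
  by (auto simp: two_algebra_data_def two_coalgebra_data_def dual_2_struct_sel
      intro!: tmap_dual_linear dual_mult_bilinear)

lemma two_coalgebra_data_dual:
  assumes "two_algebra_data G" shows "two_coalgebra_data (dual_2_struct G)"
  using assms
  by (auto simp: two_algebra_data_def two_coalgebra_data_def dual_2_struct_sel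
      intro!: tmap_dual_linear dual_comult_linear)

lemma two_units_data_dual:
  assumes "two_algebra_data G" "two_units_data G u"
  shows "two_units_data (dual_2_struct G) (dual_2_units G u)"
  using assms
  by (auto simp: two_algebra_data_def two_units_data_def dual_2_struct_sel dual_2_units_sel
      intro!: restrict0_in_dual linear_betweenI)

text \<open>Each axiom is transposed by one of the general equivalences; what remains is to fit the
  orientation of equations and the grouping of conjuncts to the two definitions.\<close>

lemma coalgebra_iff_dual_algebra:
  assumes "two_coalgebra_data G"
  shows "coassociative_2_coalgebra G \<longleftrightarrow> associative_2_algebra (dual_2_struct G)"
proof -
  have V0: "fin_dim_vspace (deg0 G)" and V1: "fin_dim_vspace (degm1 G)"
    and t: "linear_between (degm1 G) (deg0 G) (tmap G)"
    and D1: "linear_between (degm1 G) (tensor_space (degm1 G) (degm1 G)) (comultm1 G)"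
    and Dl: "linear_between (deg0 G) (tensor_space (degm1 G) (deg0 G)) (comult0l G)"
    and Dr: "linear_between (deg0 G) (tensor_space (deg0 G) (degm1 G)) (comult0r G)"
    and D': "linear_between (deg0 G) (tensor_space (deg0 G) (deg0 G)) (comult0' G)"
    using assms by (auto simp: two_coalgebra_data_def)
  note V = V0 V1 and ids = linear_between_id(1)
  \<comment> \<open>The identity is written as an abstraction, so that \<open>\<Theta> (t y)\<close>
    in \<open>comult_hom_iff\<close> reduces to \<Theta> at y.\<close>
  have id0: "linear_between (deg0 G) (deg0 G) (\<lambda>x. x)" by simp
  note a1 = coassoc_iff[OF V1 V1 V1 V1 V1 V1 D1 D1 D1 D1]
  note a2 = coassoc_iff[OF V0 V0 V0 V0 V0 V0 D' D' D' D']
  note a3 = coassoc_iff[OF V0 V1 V0 V1 V1 V0 Dl D1 Dl Dl]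
  \<comment> \<open>The law for the right action by a product is stated with its two sides in the
    opposite order.\<close>
  note a4 = coassoc_iff[OF V0 V0 V1 V0 V1 V1 Dr Dr Dr D1, unfolded
      eq_commute[of "dual_mult _ _ _ _ (dual_mult _ _ _ _ _ _) _"]]
  note a5 = coassoc_iff[OF V0 V0 V0 V1 V0 V1 Dr Dl Dl Dr]
  note h1 = comult_hom_iff[OF V1 V0 V0 V0 V1 V1 D' t D1 t t]
  note h2 = comult_hom_iff[OF V1 V0 V0 V1 V1 V1 Dr t D1 t ids]
  note h3 = comult_hom_iff[OF V1 V0 V1 V0 V1 V1 Dl t D1 ids t]
  note h4 = comult_hom_iff[OF V0 V0 V0 V0 V1 V0 D' id0 Dl t ids, unfolded eq_commute[of "restrict0 _ _"]]
  note h5 = comult_hom_iff[OF V0 V0 V0 V0 V0 V1 D' id0 Dr ids t, unfolded eq_commute[of "restrict0 _ _"]]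
  \<comment> \<open>Removes the outer \<open>restrict0\<close> from \<open>h4\<close> and
    \<open>h5\<close>, where the map being transposed is the identity.\<close>
  have mult_in: "dual_mult (deg0 G) (deg0 G) (deg0 G) (comult0' G) f g \<in> vcarrier (dual_space (deg0 G))"
    if "f \<in> vcarrier (dual_space (deg0 G))" "g \<in> vcarrier (dual_space (deg0 G))" for f g
    using that by (intro dual_mult_in V D')
  have data: "two_algebra_data (dual_2_struct G)" using assms by (rule two_algebra_data_dual)
  show ?thesis
    unfolding coassociative_2_coalgebra_def associative_2_algebra_def Let_def
      ball_conj_distrib eq_commute[of "tensor_map _ _ _ _ _ _ _"]
    \<comment> \<open>After the rewriting, the operations of the dual structure are folded back; the
      transpose of t is folded in applied form, as it occurs here. Only propositional and quantifier
      bookkeeping is left.\<close>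
    by (simp only: assms data simp_thms a1 a2 a3 a4 a5 h1 h2 h3 h4 h5 id_apply,
        simp add: restrict0_dual mult_in cong: ball_cong_simp,
        fold dual_2_struct_tmap dual_2_struct_sel(1,2,4-))
       (intro iffI; elim conjE; intro conjI ballI; meson)
qed

lemma counital_iff_dual_unital:
  assumes "two_coalgebra_data G" "two_units_data G u"
  shows "counital_2_coalgebra G u \<longleftrightarrow> unital_2_algebra (dual_2_struct G) (dual_2_units G u)"
proof -
  have V0: "fin_dim_vspace (deg0 G)" and V1: "fin_dim_vspace (degm1 G)"
    and t: "linear_between (degm1 G) (deg0 G) (tmap G)"
    and D1: "linear_between (degm1 G) (tensor_space (degm1 G) (degm1 G)) (comultm1 G)"
    and Dl: "linear_between (deg0 G) (tensor_space (degm1 G) (deg0 G)) (comult0l G)"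
    and Dr: "linear_between (deg0 G) (tensor_space (deg0 G) (degm1 G)) (comult0r G)"
    and D': "linear_between (deg0 G) (tensor_space (deg0 G) (deg0 G)) (comult0' G)"
    using assms by (auto simp: two_coalgebra_data_def)
  have e0: "linear_between (deg0 G) ground (counit0 u)" and e1: "linear_between (degm1 G) ground (counitm1 u)"
    using assms(2) by (auto simp: two_units_data_def)
  \<comment> \<open>The one counit law without a comultiplication: it says that the transpose of t
    carries one unit of the dual to the other.\<close>
  have "(\<forall>y\<in>vcarrier (degm1 G). counitm1 u y = counit0 u (tmap G y)) \<longleftrightarrow>
      restrict0 (degm1 G) (\<lambda>y. restrict0 (deg0 G) (counit0 u) (tmap G y)) = restrict0 (degm1 G) (counitm1 u)"
    using linear_between_in[OF t] by (auto simp: restrict0_def fun_eq_iff)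
  then show ?thesis
    unfolding counital_2_coalgebra_def unital_2_algebra_def Let_def dual_2_struct_sel dual_2_units_sel
      ball_conj_distrib
    by (simp only: counit_left_iff[OF V1 V1 D1 e1] counit_right_iff[OF V1 V1 D1 e1]
        counit_left_iff[OF V1 V0 Dl e1] counit_right_iff[OF V1 V0 Dr e1]
        counit_left_iff[OF V0 V0 D' e0] counit_right_iff[OF V0 V0 D' e0] conj_ac)
qed

text \<open>The canonical map \<open>dual_eval\<close> is an isomorphism of the algebra part onto
  that of the double dual, whose products and actions arise from those of \<open>G\<close> alone;
  hence the algebra data suffice as hypothesis.\<close>

lemma
  assumes "two_algebra_data G"
  shows bidual_deg0: "vcarrier (deg0 (dual_2_struct (dual_2_struct G))) = dual_eval (deg0 G) ` vcarrier (deg0 G)"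
    and bidual_degm1: "vcarrier (degm1 (dual_2_struct (dual_2_struct G))) = dual_eval (degm1 G) ` vcarrier (degm1 G)"
    and bidual_tmap: "y \<in> vcarrier (degm1 G) \<Longrightarrow>
      tmap (dual_2_struct (dual_2_struct G)) (dual_eval (degm1 G) y) = dual_eval (deg0 G) (tmap G y)"
    and bidual_mult0: "\<lbrakk>x \<in> vcarrier (deg0 G); x' \<in> vcarrier (deg0 G)\<rbrakk> \<Longrightarrow>
      mult0 (dual_2_struct (dual_2_struct G)) (dual_eval (deg0 G) x) (dual_eval (deg0 G) x') =
      dual_eval (deg0 G) (mult0 G x x')"
    and bidual_multm1: "\<lbrakk>y \<in> vcarrier (degm1 G); y' \<in> vcarrier (degm1 G)\<rbrakk> \<Longrightarrow>
      multm1 (dual_2_struct (dual_2_struct G)) (dual_eval (degm1 G) y) (dual_eval (degm1 G) y') =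
      dual_eval (degm1 G) (multm1 G y y')"
    and bidual_lact: "\<lbrakk>x \<in> vcarrier (deg0 G); y \<in> vcarrier (degm1 G)\<rbrakk> \<Longrightarrow>
      lact (dual_2_struct (dual_2_struct G)) (dual_eval (deg0 G) x) (dual_eval (degm1 G) y) =
      dual_eval (degm1 G) (lact G x y)"
    and bidual_ract: "\<lbrakk>x \<in> vcarrier (deg0 G); y \<in> vcarrier (degm1 G)\<rbrakk> \<Longrightarrow>
      ract (dual_2_struct (dual_2_struct G)) (dual_eval (degm1 G) y) (dual_eval (deg0 G) x) =
      dual_eval (degm1 G) (ract G y x)"
proof -
  have V0: "fin_dim_vspace (deg0 G)" and V1: "fin_dim_vspace (degm1 G)"
    and t: "linear_between (degm1 G) (deg0 G) (tmap G)"
    using assms by (auto simp: two_algebra_data_def)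
  show "vcarrier (deg0 (dual_2_struct (dual_2_struct G))) = dual_eval (deg0 G) ` vcarrier (deg0 G)"
    "vcarrier (degm1 (dual_2_struct (dual_2_struct G))) = dual_eval (degm1 G) ` vcarrier (degm1 G)"
    by (simp_all add: dual_2_struct_sel dual_dual_carrier V0 V1)
  show "tmap (dual_2_struct (dual_2_struct G)) (dual_eval (degm1 G) y) = dual_eval (deg0 G) (tmap G y)"
    if "y \<in> vcarrier (degm1 G)"
    using that linear_between_in[OF tmap_dual_linear[OF V1 V0 t]]
    by (auto simp: dual_2_struct_sel dual_eval_def[of "deg0 G"] intro!: restrict0_cong)
qed (use assms in \<open>simp_all add: two_algebra_data_def dual_2_struct_sel dual_mult_dual_comult\<close>)

text \<open>Quantifiers over the bidual carriers become quantifiers over images of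
  \<open>dual_eval\<close>; the operations are pulled back through it, and injectivity cancels it
  from every equation.\<close>

lemma algebra_iff_bidual_algebra:
  assumes "two_algebra_data G"
  shows "associative_2_algebra G \<longleftrightarrow> associative_2_algebra (dual_2_struct (dual_2_struct G))"
proof -
  have data: "fin_dim_vspace (deg0 G)" "fin_dim_vspace (degm1 G)"
    "linear_between (degm1 G) (deg0 G) (tmap G)"
    "bilinear_between (deg0 G) (deg0 G) (deg0 G) (mult0 G)"
    "bilinear_between (degm1 G) (degm1 G) (degm1 G) (multm1 G)"
    "bilinear_between (deg0 G) (degm1 G) (degm1 G) (lact G)"
    "bilinear_between (degm1 G) (deg0 G) (degm1 G) (ract G)"
    using assms by (auto simp: two_algebra_data_def)
  note closed = linear_between_in[OF data(3)] data(4-)[THEN bilinear_between_in]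
  note bidual = bidual_deg0 bidual_degm1 bidual_tmap bidual_mult0 bidual_multm1 bidual_lact bidual_ract
  have "two_algebra_data (dual_2_struct (dual_2_struct G))"
    using assms by (intro two_algebra_data_dual two_coalgebra_data_dual)
  then show ?thesis
    unfolding associative_2_algebra_def using assms
    by (simp add: bidual[OF assms] closed dual_eval_inject data(1,2) cong: ball_cong_simp)
qed

lemma unital_iff_bidual_unital:
  assumes "two_algebra_data G" "two_units_data G u"
  shows "unital_2_algebra G u \<longleftrightarrow>
    unital_2_algebra (dual_2_struct (dual_2_struct G)) (dual_2_units (dual_2_struct G) (dual_2_units G u))"
proof -
  have data: "fin_dim_vspace (deg0 G)" "fin_dim_vspace (degm1 G)"
    "linear_between (degm1 G) (deg0 G) (tmap G)"
    "bilinear_between (deg0 G) (deg0 G) (deg0 G) (mult0 G)"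
    "bilinear_between (degm1 G) (degm1 G) (degm1 G) (multm1 G)"
    "bilinear_between (deg0 G) (degm1 G) (degm1 G) (lact G)"
    "bilinear_between (degm1 G) (deg0 G) (degm1 G) (ract G)"
    "unit0 u \<in> vcarrier (deg0 G)" "unitm1 u \<in> vcarrier (degm1 G)"
    using assms by (auto simp: two_algebra_data_def two_units_data_def)
  note closed = linear_between_in[OF data(3)] data(4-7)[THEN bilinear_between_in]
  note bidual = bidual_deg0 bidual_degm1 bidual_tmap bidual_mult0 bidual_multm1 bidual_lact bidual_ract
  \<comment> \<open>Units become counits and then units again: the result is evaluation at the
    original unit.\<close>
  have "unit0 (dual_2_units (dual_2_struct G) (dual_2_units G u)) = dual_eval (deg0 G) (unit0 u)"
    "unitm1 (dual_2_units (dual_2_struct G) (dual_2_units G u)) = dual_eval (degm1 G) (unitm1 u)"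
    by (simp_all add: dual_2_units_sel dual_2_struct_sel dual_eval_def)
  then show ?thesis
    unfolding unital_2_algebra_def
    by (simp add: bidual[OF assms(1)] closed dual_eval_inject data cong: ball_cong_simp)
qed

text \<open>The hypotheses supply finite-dimensional spaces and linear or bilinear maps, but no
  axiom; with them the dual operations are well defined, and the equivalence concerns the axioms. In
  the unital clause, units and counits are likewise given as mere data.\<close>

theorem proposition3p1:
  fixes G :: "('k::field, 'a::ab_group_add, 'b::ab_group_add) two_struct"
  assumes "two_algebra_data G" and "two_coalgebra_data G"
  shows "(associative_2_bialgebra G \<longleftrightarrow> associative_2_bialgebra (dual_2_struct G)) \<and>
    (\<forall>u. two_units_data G u \<longrightarrow>
      (unital_associative_2_bialgebra G u \<longleftrightarrow>
       unital_associative_2_bialgebra (dual_2_struct G) (dual_2_units G u)))"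
proof -
  let ?H = "dual_2_struct G"
  have dual_data: "two_algebra_data ?H" "two_coalgebra_data ?H"
    using assms by (simp_all add: two_algebra_data_dual two_coalgebra_data_dual)
  have V0: "fin_dim_vspace (deg0 G)" and V1: "fin_dim_vspace (degm1 G)"
    and m0: "bilinear_between (deg0 G) (deg0 G) (deg0 G) (mult0 G)"
    and m1: "bilinear_between (degm1 G) (degm1 G) (degm1 G) (multm1 G)"
    and la: "bilinear_between (deg0 G) (degm1 G) (degm1 G) (lact G)"
    and ra: "bilinear_between (degm1 G) (deg0 G) (degm1 G) (ract G)"
    using assms(1) by (auto simp: two_algebra_data_def)
  have D1: "linear_between (degm1 G) (tensor_space (degm1 G) (degm1 G)) (comultm1 G)"
    and Dl: "linear_between (deg0 G) (tensor_space (degm1 G) (deg0 G)) (comult0l G)"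
    and Dr: "linear_between (deg0 G) (tensor_space (deg0 G) (degm1 G)) (comult0r G)"
    and D': "linear_between (deg0 G) (tensor_space (deg0 G) (deg0 G)) (comult0' G)"
    using assms(2) by (auto simp: two_coalgebra_data_def)
  \<comment> \<open>The coalgebra equivalence is applied to \<open>?H\<close>; the double dual that
    it produces is traded for \<open>G\<close>.\<close>
  have algebra: "associative_2_algebra G \<longleftrightarrow> coassociative_2_coalgebra ?H"
    using algebra_iff_bidual_algebra[OF assms(1)] coalgebra_iff_dual_algebra[OF dual_data(2)] by simp
  note coalgebra = coalgebra_iff_dual_algebra[OF assms(2)]
  \<comment> \<open>In this order, the conditions of \<open>G\<close> for the left action, the right
    action, \<open>comult0l\<close> and \<open>comult0r\<close>. Their transposes are the conditions
    of \<open>?H\<close> for \<open>comult0l\<close>, \<open>comult0r\<close>, the left action and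
    the right action.\<close>
  note compat =
    compatible_iff[OF V0 V1 V1 V0 V0 V1 V1 V1 V1 D' D1 D1 la la la, folded dual_2_struct_sel]
    compatible_iff[OF V1 V0 V1 V1 V1 V0 V0 V1 V1 D1 D' D1 ra ra ra, folded dual_2_struct_sel]
    compatible_iff[OF V0 V0 V0 V1 V0 V1 V0 V1 V0 Dl Dl Dl m0 m1 m0, folded dual_2_struct_sel]
    compatible_iff[OF V0 V0 V0 V0 V1 V0 V1 V0 V1 Dr Dr Dr m0 m0 m1, folded dual_2_struct_sel]
  have bialgebra: "associative_2_bialgebra G \<longleftrightarrow> associative_2_bialgebra ?H"
    unfolding associative_2_bialgebra_def Let_def algebra coalgebra ball_conj_distrib
    using compat by (simp only:) meson
  moreover have "unital_associative_2_bialgebra G u \<longleftrightarrow>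
      unital_associative_2_bialgebra ?H (dual_2_units G u)" if u: "two_units_data G u" for u
  proof -
    have dual_u: "two_units_data ?H (dual_2_units G u)"
      using assms(1) u by (rule two_units_data_dual)
    \<comment> \<open>Again through the double dual: the counit laws of \<open>?H\<close> are the
      unit laws of its dual.\<close>
    have "unital_2_algebra G u \<longleftrightarrow> counital_2_coalgebra ?H (dual_2_units G u)"
      using unital_iff_bidual_unital[OF assms(1) u] counital_iff_dual_unital[OF dual_data(2) dual_u] by simp
    then show ?thesis
      unfolding unital_associative_2_bialgebra_def
      using bialgebra counital_iff_dual_unital[OF assms(2) u] u dual_u by auto
  qed
  ultimately show ?thesis by blast
qed

end
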